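(* Let $\epsilon>0$ and let $k,l,m\ge 2$ be integers. Then for positive integers $h\le x^{1-\epsilon}$, $$\mathcal{T}(d_k,d_l,d_m;x,h):=\sum_{n\le x} d_k(n+h)\,d_l(n)\,d_m(n-h)\ \ge\ \frac{\nabla_{h,k,l,m}}{3^{k+l+m-3}}\,\frac{x(\log x)^{k+l+m-3}}{(k-1)!\,(l-1)!\,(m-1)!}+O\!\left(x(\log x)^{k+l+m-4}\right)$$ as $x\to\infty$.
   Context: For integers $k\ge1$ and $n\ge1$, $d_k(n)$ denotes the number of $k$-tuples $(x_1,\dots,x_k)\in\mathbb{N}^k$ of positive integers with $x_1\cdots x_k=n$ (so $d_1\equiv 1$ and $d_2$ is the usual divisor function). For positive integers $u,v,w$, $[u,v,w]$ denotes their least common multiple, and $g(u,v,w)=1$ if the system of congruences $n\equiv -h \pmod u$, $n\equiv 0\pmod v$, $n\equiv h\pmod w$ has an integer solution $n$, and $g(u,v,w)=0$ otherwise. The constant $\nabla_{h,k,l,m}$ is $$\nabla_{h,k,l,m}=\prod_{p\mid 2h}\left[\left(1-\frac1p\right)^{k+l+m-3}\sum_{\nu_1,\nu_2,\nu_3\ge 0} d_{k-1}(p^{\nu_1})d_{l-1}(p^{\nu_2})d_{m-1}(p^{\nu_3})\frac{g(p^{\nu_1},p^{\nu_2},p^{\nu_3})}{[p^{\nu_1},p^{\nu_2},p^{\nu_3}]}\right]\times\prod_{p\nmid 2h}\left[\left(1-\frac1p\right)^{k+l+m-3}\left\{\left(1-\frac1p\right)^{1-k}+\left(1-\frac1p\right)^{1-l}+\left(1-\frac1p\right)^{1-m}-2\right\}\right],$$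 where $p$ runs over primes. *)

theory Defs
  imports "HOL-Analysis.Analysis" "HOL-Number_Theory.Number_Theory"
begin

definition d :: "nat \<Rightarrow> nat \<Rightarrow> nat" where
  "d k n = card {xs :: nat list. length xs = k \<and> (\<forall>x\<in>set xs. x > 0) \<and> prod_list xs = n}"

lemma d_0_right: "d k 0 = 0"
proof -
  have "{xs :: nat list. length xs = k \<and> (\<forall>x\<in>set xs. x > 0) \<and> prod_list xs = 0} = {}"
    by (auto simp: prod_list_zero_iff)
  then show ?thesis
    unfolding d_def by (simp only: card.empty)
qed

text \<open>Truncated subtraction is harmless here: for \<open>n \<le> h\<close> it gives \<open>n - h = 0\<close>, and
  \<open>d m 0 = 0\<close> by \<open>d_0_right\<close>, in agreement with the fact that a nonpositive integer is not a
  product of positive integers. So the sum effectively ranges over \<open>h < n \<le> x\<close>.\<close>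

definition T :: "nat \<Rightarrow> nat \<Rightarrow> nat \<Rightarrow> real \<Rightarrow> nat \<Rightarrow> real" where
  "T k l m x h = (\<Sum>n | 1 \<le> n \<and> real n \<le> x. real (d k (n + h) * d l n * d m (n - h)))"

definition g :: "nat \<Rightarrow> nat \<Rightarrow> nat \<Rightarrow> nat \<Rightarrow> real" where
  "g h u v w =
     (if \<exists>n::int. [n = - int h] (mod int u) \<and> [n = 0] (mod int v) \<and> [n = int h] (mod int w)
      then 1 else 0)"

definition local_factor_dvd :: "nat \<Rightarrow> nat \<Rightarrow> nat \<Rightarrow> nat \<Rightarrow> nat \<Rightarrow> real" where
  "local_factor_dvd h k l m p =
     (1 - 1 / real p) ^ (k + l + m - 3) *
     (\<Sum>\<^sub>\<infinity>(a, b, c)\<in>(UNIV :: (nat \<times> nat \<times> nat) set).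
        real (d (k - 1) (p ^ a)) * real (d (l - 1) (p ^ b)) * real (d (m - 1) (p ^ c)) *
        (g h (p ^ a) (p ^ b) (p ^ c) / real (lcm (p ^ a) (lcm (p ^ b) (p ^ c)))))"

definition local_factor_not_dvd :: "nat \<Rightarrow> nat \<Rightarrow> nat \<Rightarrow> nat \<Rightarrow> real" where
  "local_factor_not_dvd k l m p =
     (1 - 1 / real p) ^ (k + l + m - 3) *
     ((1 - 1 / real p) powi (1 - int k) + (1 - 1 / real p) powi (1 - int l) +
      (1 - 1 / real p) powi (1 - int m) - 2)"

text \<open>The product over the primes not dividing \<open>2 * h\<close> is written as a product over all naturals
  whose remaining factors are 1; its factors are \<open>1 + O(1 / p\<^sup>2)\<close> and positive.\<close>

definition nabla :: "nat \<Rightarrow> nat \<Rightarrow> nat \<Rightarrow> nat \<Rightarrow> real" where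
  "nabla h k l m =
     (\<Prod>p | prime p \<and> p dvd 2 * h. local_factor_dvd h k l m p) *
     (\<Prod>p. if prime p \<and> \<not> p dvd 2 * h then local_factor_not_dvd k l m p else 1)"

end

theory Submission
  imports Defs "HOL-Computational_Algebra.Squarefree" "HOL-Real_Asymp.Real_Asymp"
begin

text \<open>
  Expanding \<open>d k n\<close> as the sum of \<open>d (k - 1) u\<close> over the divisors \<open>u\<close> of \<open>n\<close>, and keeping only
  divisor triples with \<open>u * v * w \<le> y = x / ln x\<close>, bounds \<open>T k l m x h\<close> from below by \<open>x - h\<close> times
  the sum of \<open>d (k - 1) u * d (l - 1) v * d (m - 1) w * g h u v w / lcm u (lcm v w)\<close>, up to
  \<open>O (x * ln x ^ (K - 1))\<close> with \<open>K = k + l + m - 3\<close>. The region \<open>u * v * w \<le> y\<close> produces the constant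
  \<open>1 / K!\<close>, which is strictly larger than the required \<open>1 / (3 ^ K * (k - 1)! * (l - 1)! * (m - 1)!)\<close>;
  this slack absorbs every relative error, uniformly in \<open>h\<close>.

  Let \<open>B\<close> consist of the primes that are at most a large constant \<open>z\<close> or divide \<open>2 * h\<close>. Every summand
  factors into a \<open>B\<close>-smooth part and, if one restricts to squarefree cofactors, a part prime to \<open>B\<close>
  whose summands combine to \<open>d K r / r\<close>. The cofactor sum needs no asymptotics: since
  every \<open>n\<close> is a squarefree number prime to \<open>B\<close> times a number whose remaining primes lie in \<open>B\<close> or
  occur at least squared, it dominates \<open>(\<Prod>p\<in>B. (1 - 1 / p) ^ K) * exp (- c / z)\<close> times the full sum
  of \<open>d K n / n\<close>. The smooth part is summed by Markov's inequality for the logarithm of its size,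
  which is small on average because the sum of \<open>ln p / p\<close> over \<open>B\<close> is at most \<open>z + ln (2 * h) / z\<close>.
  The result is the product over \<open>B\<close> of the local factors of \<open>nabla\<close>, and this product is at least
  \<open>nabla\<close> because the local factors at primes not dividing \<open>2 * h\<close> are at most 1.
\<close>


section \<open>The divisor functions\<close>

definition factorizations :: "nat \<Rightarrow> nat \<Rightarrow> nat list set" where
  "factorizations k n = {xs. length xs = k \<and> (\<forall>x\<in>set xs. x > 0) \<and> prod_list xs = n}"

lemma d_eq_card: "d k n = card (factorizations k n)"
  by (simp add: d_def factorizations_def)

lemma finite_factorizations:
  assumes "n > 0"
  shows "finite (factorizations k n)"
proof (rule finite_subset)
  have "x dvd prod_list xs" if "x \<in> set xs" for x :: nat and xs
    using that by (induction xs) auto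
  then show "factorizations k n \<subseteq> {xs. set xs \<subseteq> {..n} \<and> length xs = k}"
    using assms by (force simp: factorizations_def dest: dvd_imp_le)
  show "finite {xs. set xs \<subseteq> {..n} \<and> length xs = k}"
    by (rule finite_lists_length_eq) simp
qed

lemma d_0: "d 0 n = (if n = 1 then 1 else 0)"
proof -
  have "factorizations 0 n = (if n = 1 then {[]} else {})"
    by (auto simp: factorizations_def)
  then show ?thesis by (simp add: d_eq_card)
qed

lemma d_1:
  assumes "n > 0"
  shows "d 1 n = 1"
proof -
  have "factorizations 1 n = {[n]}"
    using assms by (auto simp: factorizations_def length_Suc_conv)
  then show ?thesis by (simp add: d_eq_card)
qed

text \<open>Cutting a list after its first \<open>j\<close> entries is a bijection onto pairs of
  lists. The union is disjoint because the list determines the product \<open>a\<close> of its first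
  piece. In effect \<open>d (j + k)\<close> is the Dirichlet convolution of \<open>d j\<close> and
  \<open>d k\<close>.\<close>

lemma d_add:
  assumes n: "n > 0"
  shows "d (j + k) n = (\<Sum>a | a dvd n. d j a * d k (n div a))"
proof -
  have fin: "finite {a. a dvd n}" using n by simp
  have pos: "a > 0" "n div a > 0" if "a dvd n" for a
    using that n by (auto intro: Nat.gr0I)
  have eq: "factorizations (j + k) n =
      (\<Union>a\<in>{a. a dvd n}. (\<lambda>(xs, ys). xs @ ys) ` (factorizations j a \<times> factorizations k (n div a)))"
    (is "?L = ?R")
  proof
    show "?L \<subseteq> ?R"
    proof
      fix zs assume zs: "zs \<in> ?L"
      define xs ys where "xs = take j zs" and "ys = drop j zs"
      have app: "zs = xs @ ys" by (simp add: xs_def ys_def)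
      have len: "length xs = j" "length ys = k"
        using zs by (auto simp: xs_def ys_def factorizations_def)
      have prod: "prod_list xs * prod_list ys = n"
        using zs by (auto simp: app factorizations_def)
      have "\<forall>x\<in>set xs. x > 0" "\<forall>x\<in>set ys. x > 0"
        using zs by (auto simp: app factorizations_def)
      moreover have "n div prod_list xs = prod_list ys"
        using prod n by (metis mult_eq_0_iff nonzero_mult_div_cancel_left not_less_zero)
      ultimately have "(xs, ys) \<in> factorizations j (prod_list xs) \<times> factorizations k (n div prod_list xs)"
        using len by (auto simp: factorizations_def)
      moreover have "prod_list xs dvd n" using prod by (metis dvd_triv_left)
      ultimately show "zs \<in> ?R" unfolding app by force
    qed
    show "?R \<subseteq> ?L" by (auto simp: factorizations_def)
  qed
  have inj: "inj_on (\<lambda>(xs, ys). xs @ ys) (factorizations j a \<times> factorizations k b)" for a b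
    by (auto simp: inj_on_def factorizations_def)
  have "card ?R = (\<Sum>a\<in>{a. a dvd n}. card ((\<lambda>(xs, ys). xs @ ys) ` (factorizations j a \<times> factorizations k (n div a))))"
  proof (rule card_UN_disjoint[OF fin])
    show "\<forall>a\<in>{a. a dvd n}. finite ((\<lambda>(xs, ys). xs @ ys) ` (factorizations j a \<times> factorizations k (n div a)))"
      using pos by (blast intro: finite_cartesian_product finite_factorizations)
    show "\<forall>a\<in>{a. a dvd n}. \<forall>b\<in>{a. a dvd n}. a \<noteq> b \<longrightarrow>
        (\<lambda>(xs, ys). xs @ ys) ` (factorizations j a \<times> factorizations k (n div a)) \<inter>
        (\<lambda>(xs, ys). xs @ ys) ` (factorizations j b \<times> factorizations k (n div b)) = {}"
    proof (intro ballI impI equals0I)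
      fix a b zs assume "a \<noteq> b"
        and zs: "zs \<in> (\<lambda>(xs, ys). xs @ ys) ` (factorizations j a \<times> factorizations k (n div a)) \<inter>
          (\<lambda>(xs, ys). xs @ ys) ` (factorizations j b \<times> factorizations k (n div b))"
      from zs obtain xs ys where "zs = xs @ ys" "xs \<in> factorizations j a" by auto
      moreover from zs obtain xs' ys' where "zs = xs' @ ys'" "xs' \<in> factorizations j b" by auto
      ultimately have "xs @ ys = xs' @ ys'" "xs \<in> factorizations j a" "xs' \<in> factorizations j b"
        by simp_all
      then have "xs = xs'" "prod_list xs = a" "prod_list xs' = b"
        by (auto simp: factorizations_def)
      then show False using \<open>a \<noteq> b\<close> by simp
    qed
  qed
  then show ?thesis
    unfolding d_eq_card eq by (simp add: card_image[OF inj] card_cartesian_product)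
qed

lemma d_Suc:
  assumes n: "n > 0"
  shows "d (Suc k) n = (\<Sum>a | a dvd n. d k a)"
proof -
  have "n div a > 0" if "a dvd n" for a
    using that n by (auto intro: Nat.gr0I)
  then have "d 1 (n div a) = 1" if "a dvd n" for a
    using that d_1 by blast
  then show ?thesis using d_add[OF n, of k 1] by simp
qed

lemma d_one_right: "d k 1 = 1"
  by (induction k) (simp_all add: d_0 d_Suc)

text \<open>Induction on \<open>k\<close> through \<open>d_Suc\<close>: for coprime arguments the
  divisors of \<open>m * n\<close> correspond to pairs of divisors of \<open>m\<close> and
  \<open>n\<close>, so the divisor sum factors.\<close>

lemma d_mult:
  assumes "coprime m n"
  shows "d k (m * n) = d k m * d k n"
\<comment> \<open>\<open>d_Suc\<close> speaks of positive arguments; if an argument is zero, both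
  sides are zero.\<close>
proof (cases "m = 0 \<or> n = 0")
  case True
  then show ?thesis by (auto simp: d_0_right)
next
  case False
  then show ?thesis using assms
  proof (induction k arbitrary: m n)
    case 0
    then show ?case by (auto simp: d_0)
  next
    case (Suc k)
    have bij: "bij_betw (\<lambda>(a, b). a * b) ({a. a dvd m} \<times> {b. b dvd n}) {c. c dvd m * n}"
      unfolding bij_betw_def
    proof
      show "inj_on (\<lambda>(a, b). a * b) ({a. a dvd m} \<times> {b. b dvd n})"
      proof (rule inj_onI, clarify)
        fix a b a' b' assume *: "a dvd m" "b dvd n" "a' dvd m" "b' dvd n" "a * b = a' * b'"
        have "coprime a b'" "coprime a' b"
          using * Suc.prems(2) by (meson coprime_divisors)+
        then have "a dvd a'" "a' dvd a"
          using *(5) by (metis coprime_dvd_mult_left_iff dvd_triv_left)+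
        then have "a = a'" by (rule dvd_antisym)
        moreover have "a \<noteq> 0" using * Suc.prems(1) by auto
        ultimately show "a = a' \<and> b = b'" using *(5) by simp
      qed
      show "(\<lambda>(a, b). a * b) ` ({a. a dvd m} \<times> {b. b dvd n}) = {c. c dvd m * n}"
      proof safe
        fix a b assume "a dvd m" "b dvd n" then show "a * b dvd m * n" by (rule mult_dvd_mono)
      next
        fix c assume "c dvd m * n"
        then obtain a b where "c = a * b" "a dvd m" "b dvd n" by (rule dvd_productE)
        then show "c \<in> (\<lambda>(a, b). a * b) ` ({a. a dvd m} \<times> {b. b dvd n})" by force
      qed
    qed
    have IH: "d k (a * b) = d k a * d k b" if "a dvd m" "b dvd n" for a b
      using that Suc by (metis coprime_divisors dvd_0_left_iff)
    have "d (Suc k) (m * n) = (\<Sum>c | c dvd m * n. d k c)"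
      using Suc.prems by (intro d_Suc) auto
    also have "\<dots> = (\<Sum>(a, b)\<in>{a. a dvd m} \<times> {b. b dvd n}. d k (a * b))"
      using sum.reindex_bij_betw[OF bij, of "d k"] by (simp add: case_prod_unfold)
    also have "\<dots> = (\<Sum>(a, b)\<in>{a. a dvd m} \<times> {b. b dvd n}. d k a * d k b)"
      using IH by (intro sum.cong) auto
    also have "\<dots> = (\<Sum>a | a dvd m. d k a) * (\<Sum>b | b dvd n. d k b)"
      by (simp add: sum_product sum.cartesian_product)
    also have "\<dots> = d (Suc k) m * d (Suc k) n"
      using Suc.prems by (simp add: d_Suc)
    finally show ?case .
  qed
qed

lemma coprime_prime_power_prod:
  fixes p :: nat
  assumes "prime p" "\<And>q. q \<in> P \<Longrightarrow> prime q" "p \<notin> P"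
  shows "coprime (p ^ i) (\<Prod>q\<in>P. q ^ e q)"
  using assms by (intro prod_coprime_right) (metis coprime_power_left_iff coprime_power_right_iff primes_coprime)

lemma d_prod_prime_powers:
  assumes "finite P" "\<And>p. p \<in> P \<Longrightarrow> prime p"
  shows "d k (\<Prod>p\<in>P. p ^ e p) = (\<Prod>p\<in>P. d k (p ^ e p))"
  using assms
proof (induction P rule: finite_induct)
  case empty
  show ?case by (simp add: d_one_right[unfolded One_nat_def])
next
  case (insert p P)
  then show ?case
    using coprime_prime_power_prod[of p P "e p" e] by (simp add: d_mult)
qed

section \<open>Values at prime powers and their Euler factors\<close>

lemma d_Suc_prime_power:
  assumes "prime p"
  shows "d (Suc k) (p ^ j) = (\<Sum>i\<le>j. d k (p ^ i))"
proof -
  have "{a. a dvd p ^ j} = (\<lambda>i. p ^ i) ` {..j}"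
    using assms by (auto simp: divides_primepow_nat le_imp_power_dvd)
  moreover have "inj_on (\<lambda>i. p ^ i) {..j}"
    using prime_gt_1_nat[OF assms] by (auto simp: inj_on_def)
  ultimately show ?thesis
    using assms by (simp add: d_Suc prime_gt_0_nat sum.reindex)
qed

text \<open>Summing over the exponents up to \<open>j\<close> costs one factor \<open>j + 1\<close>
  for each step in \<open>k\<close>. A bound that is polynomial in \<open>j\<close> leaves geometric
  decay in charge of every series over prime powers.\<close>

lemma d_prime_power_le:
  assumes "prime p"
  shows "d k (p ^ j) \<le> (j + 1) ^ k"
proof (induction k arbitrary: j)
  case 0
  then show ?case by (simp add: d_0)
next
  case (Suc k)
  have "d (Suc k) (p ^ j) \<le> (\<Sum>i\<le>j. (j + 1) ^ k)"
    unfolding d_Suc_prime_power[OF assms]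
    by (intro sum_mono order.trans[OF Suc.IH] power_mono) auto
  then show ?case by simp
qed

text \<open>This is the Euler factor at \<open>p\<close> of the \<open>k\<close>-th power of zeta,
  evaluated at 1. Raising \<open>k\<close> by one turns values into partial sums, which is the
  Cauchy product with a geometric series.\<close>

lemma d_prime_power_sums:
  assumes "prime p"
  shows "(\<lambda>j. real (d k (p ^ j)) / real p ^ j) sums ((1 / (1 - 1 / real p)) ^ k)"
proof (induction k)
  case 0
  have "(\<lambda>j. real (d 0 (p ^ j)) / real p ^ j) = (\<lambda>j. if j = 0 then 1 else 0)"
    using assms by (auto simp: d_0 fun_eq_iff)
  then show ?case using sums_single[of 0 "\<lambda>_. 1::real"] by simp
next
  case (Suc k)
  have p: "real p > 1" using prime_gt_1_nat[OF assms] by simp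
  have geo: "(\<lambda>j. (1 / real p) ^ j) sums (1 / (1 - 1 / real p))"
    using p by (intro geometric_sums) auto
  have "(\<lambda>j. \<Sum>i\<le>j. (real (d k (p ^ i)) / real p ^ i) * (1 / real p) ^ (j - i)) sums
      ((\<Sum>j. real (d k (p ^ j)) / real p ^ j) * (\<Sum>j. (1 / real p) ^ j))"
  proof (rule Cauchy_product_sums)
    have "norm (real (d k (p ^ j)) / real p ^ j) = real (d k (p ^ j)) / real p ^ j" for j
      by simp
    then show "summable (\<lambda>j. norm (real (d k (p ^ j)) / real p ^ j))"
      using Suc.IH by (simp only: sums_iff)
    show "summable (\<lambda>j. norm ((1 / real p) ^ j))"
      using p by (simp add: norm_power summable_geometric)
  qed
  moreover have "(\<Sum>i\<le>j. (real (d k (p ^ i)) / real p ^ i) * (1 / real p) ^ (j - i)) =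
      real (d (Suc k) (p ^ j)) / real p ^ j" for j
  proof -
    have "real (d k (p ^ i)) / real p ^ i * (1 / real p) ^ (j - i) = real (d k (p ^ i)) / real p ^ j"
      if "i \<le> j" for i
      using that p by (simp add: power_one_over power_diff)
    then show ?thesis by (simp add: d_Suc_prime_power[OF assms] sum_divide_distrib)
  qed
  ultimately show ?case using Suc.IH geo by (simp add: sums_iff mult.commute)
qed

section \<open>Logarithmic sums of the divisor functions\<close>

text \<open>The cutoff is real because it gets divided by integers, as in
  \<open>y / real a\<close>.\<close>

definition nats_le :: "real \<Rightarrow> nat set" where
  "nats_le y = {n. 1 \<le> n \<and> real n \<le> y}"

lemma nats_le_eq: "nats_le y = {1..nat \<lfloor>y\<rfloor>}"
proof -
  have "real n \<le> y \<longleftrightarrow> n \<le> nat \<lfloor>y\<rfloor>" if "1 \<le> n" for n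
    using that by linarith
  then show ?thesis by (auto simp: nats_le_def)
qed

lemma finite_nats_le [simp]: "finite (nats_le y)"
  by (simp add: nats_le_eq)

text \<open>Dirichlet's interchange of summation: \<open>n = a * b\<close> is parametrized by its
  divisor \<open>a\<close> and the cofactor \<open>b\<close>.\<close>

lemma sum_divisor_pairs:
  fixes F :: "nat \<Rightarrow> nat \<Rightarrow> real"
  shows "(\<Sum>n\<in>nats_le y. \<Sum>a | a dvd n. F a (n div a)) = (\<Sum>a\<in>nats_le y. \<Sum>b\<in>nats_le (y / real a). F a b)"
proof -
  have fin: "finite {a. a dvd n}" if "n \<in> nats_le y" for n
    using that by (auto simp: nats_le_def)
  have "(\<Sum>n\<in>nats_le y. \<Sum>a | a dvd n. F a (n div a)) =
      (\<Sum>(n, a)\<in>(SIGMA n:nats_le y. {a. a dvd n}). F a (n div a))"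
    using fin by (subst sum.Sigma) auto
  also have "\<dots> = (\<Sum>(a, b)\<in>(SIGMA a:nats_le y. nats_le (y / real a)). F a b)"
  proof (rule sum.reindex_bij_witness[of _ "\<lambda>(a, b). (a * b, a)" "\<lambda>(n, a). (a, n div a)"])
    fix z assume "z \<in> (SIGMA n:nats_le y. {a. a dvd n})"
    then obtain a b where z: "z = (a * b, a)" and ab: "a * b \<in> nats_le y"
      by (auto elim!: dvdE)
    have pos: "a \<ge> 1" "b \<ge> 1" using ab by (auto simp: nats_le_def)
    then show "(case (case z of (n, a) \<Rightarrow> (a, n div a)) of (a, b) \<Rightarrow> (a * b, a)) = z"
      by (simp add: z)
    have "real a * 1 \<le> real a * real b" using pos by (intro mult_left_mono) auto
    also have "\<dots> \<le> y" using ab by (auto simp: nats_le_def)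
    finally show "(case z of (n, a) \<Rightarrow> (a, n div a)) \<in> (SIGMA a:nats_le y. nats_le (y / real a))"
      using pos ab by (auto simp: z nats_le_def field_simps)
    show "(case case z of (n, a) \<Rightarrow> (a, n div a) of (a, b) \<Rightarrow> F a b) = (case z of (n, a) \<Rightarrow> F a (n div a))"
      by (simp add: z)
  next
    fix z assume "z \<in> (SIGMA a:nats_le y. nats_le (y / real a))"
    then show "(case (case z of (a, b) \<Rightarrow> (a * b, a)) of (n, a) \<Rightarrow> (a, n div a)) = z"
      and "(case z of (a, b) \<Rightarrow> (a * b, a)) \<in> (SIGMA n:nats_le y. {a. a dvd n})"
      by (auto simp: nats_le_def field_simps)
  qed
  also have "\<dots> = (\<Sum>a\<in>nats_le y. \<Sum>b\<in>nats_le (y / real a). F a b)"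
    by (subst sum.Sigma) auto
  finally show ?thesis .
qed

text \<open>The mean value bound for a power, by induction from splitting the next difference into
  \<open>a * (a ^ Suc n - b ^ Suc n)\<close> and \<open>b ^ Suc n * (a - b)\<close>.\<close>

lemma power_diff_le:
  fixes a b :: real
  assumes "0 \<le> b" "b \<le> a"
  shows "a ^ Suc n - b ^ Suc n \<le> real (Suc n) * a ^ n * (a - b)"
proof (induction n)
  case (Suc n)
  have "a * (a ^ Suc n - b ^ Suc n) \<le> a * (real (Suc n) * a ^ n * (a - b))"
    using Suc assms by (intro mult_left_mono) auto
  moreover have "b ^ Suc n * (a - b) \<le> a ^ Suc n * (a - b)"
    using assms by (intro mult_right_mono power_mono) auto
  ultimately show ?case by (simp add: algebra_simps)
qed simp

text \<open>A telescoping form of the comparison with the integral of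
  \<open>ln (y / t) ^ K / t\<close> over \<open>1 \<le> t \<le> y\<close>: consecutive values of
  \<open>ln (y / a) ^ Suc K\<close> differ by at most \<open>Suc K\<close> times the
  summand.\<close>

lemma ln_power_sum_ge:
  assumes y: "y \<ge> 1"
  shows "ln y ^ Suc K / real (Suc K) \<le> (\<Sum>a\<in>nats_le y. ln (y / real a) ^ K / real a)"
proof -
  \<comment> \<open>Truncation at 0 makes the first term beyond \<open>y\<close> vanish, so the sum
    telescopes to \<open>ln y ^ Suc K\<close> exactly.\<close>
  define \<psi> where "\<psi> a = (max 0 (ln (y / real a))) ^ Suc K" for a
  define n where "n = nat \<lfloor>y\<rfloor>"
  have step: "\<psi> a - \<psi> (Suc a) \<le> real (Suc K) * (ln (y / real a) ^ K / real a)" if "a \<in> nats_le y" for a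
  proof -
    have a: "real a \<ge> 1" "real a \<le> y" using that by (auto simp: nats_le_def)
    define X X' where "X = ln (y / real a)" and "X' = max 0 (ln (y / real (Suc a)))"
    have "y / real (Suc a) \<le> y / real a" using a y by (intro divide_left_mono) auto
    moreover have "y / real (Suc a) > 0" using y by auto
    ultimately have "ln (y / real (Suc a)) \<le> X" unfolding X_def using a by (subst ln_le_cancel_iff) auto
    moreover have X0: "0 \<le> X" using a by (simp add: X_def)
    ultimately have XX: "0 \<le> X'" "X' \<le> X" by (auto simp: X'_def)
    have "X - X' \<le> ln (y / real a) - ln (y / real (Suc a))" by (simp add: X_def X'_def)
    also have "\<dots> = ln (1 + 1 / real a)"
      using a y by (simp add: ln_div field_simps add_pos_pos)
    also have "\<dots> \<le> 1 / real a" using a by (intro ln_add_one_self_le_self) auto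
    finally have "real (Suc K) * X ^ K * (X - X') \<le> real (Suc K) * X ^ K * (1 / real a)"
      using X0 by (intro mult_left_mono) auto
    moreover have "\<psi> a - \<psi> (Suc a) = X ^ Suc K - X' ^ Suc K"
      using X0 by (simp add: \<psi>_def X_def X'_def)
    ultimately show ?thesis using power_diff_le[OF XX, of K] by (simp add: X_def)
  qed
  have "(\<Sum>a\<in>nats_le y. \<psi> a - \<psi> (Suc a)) = (\<Sum>a\<in>{1..n}. \<psi> a - \<psi> (Suc a))"
    by (simp add: nats_le_eq n_def)
  also have "\<dots> = \<psi> 1 - \<psi> (Suc n)"
    by (induction n) (auto simp: sum.atLeastAtMost_shift_bounds)
  also have "\<psi> (Suc n) = 0"
  proof -
    have "y / real (Suc n) < 1" using y unfolding n_def by (simp add: divide_less_eq) linarith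
    then have "ln (y / real (Suc n)) \<le> 0" using y by (intro ln_le_zero_iff[THEN iffD2]) auto
    then show ?thesis by (simp add: \<psi>_def)
  qed
  also have "\<psi> 1 = ln y ^ Suc K" using y by (simp add: \<psi>_def)
  finally have "ln y ^ Suc K = (\<Sum>a\<in>nats_le y. \<psi> a - \<psi> (Suc a))" by simp
  also have "\<dots> \<le> (\<Sum>a\<in>nats_le y. real (Suc K) * (ln (y / real a) ^ K / real a))"
    by (intro sum_mono step)
  also have "\<dots> = real (Suc K) * (\<Sum>a\<in>nats_le y. ln (y / real a) ^ K / real a)"
    by (simp only: sum_distrib_left)
  finally show ?thesis by (simp add: divide_le_eq mult.commute del: of_nat_Suc)
qed

text \<open>Peeling off one factor \<open>a\<close> gives a recursion in \<open>K\<close> with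
  cutoff \<open>y / a\<close>; it drives both the lower and the upper bound below.\<close>

lemma sum_d_Suc:
  "(\<Sum>n\<in>nats_le y. real (d (Suc K) n) / real n) =
   (\<Sum>a\<in>nats_le y. (\<Sum>b\<in>nats_le (y / real a). real (d K b) / real b) / real a)"
proof -
  have "(\<Sum>n\<in>nats_le y. real (d (Suc K) n) / real n) =
      (\<Sum>n\<in>nats_le y. \<Sum>a | a dvd n. real (d K (n div a)) / real (n div a) / real a)"
  proof (rule sum.cong)
    fix n assume "n \<in> nats_le y"
    then have n: "n > 0" by (auto simp: nats_le_def)
    have "d 1 a * d K (n div a) = d K (n div a)" if "a dvd n" for a
    proof -
      have "a > 0" using that n by (auto intro: Nat.gr0I)
      then have "d 1 a = 1" by (rule d_1)
      then show ?thesis by simp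
    qed
    then have "(\<Sum>a | a dvd n. d 1 a * d K (n div a)) = (\<Sum>a | a dvd n. d K (n div a))"
      by (intro sum.cong refl) blast
    then have "d (Suc K) n = (\<Sum>a | a dvd n. d K (n div a))"
      using d_add[OF n, of 1 K] by (simp only: plus_1_eq_Suc)
    then have "real (d (Suc K) n) / real n = (\<Sum>a | a dvd n. real (d K (n div a)) / real n)"
      by (simp add: sum_divide_distrib)
    also have "\<dots> = (\<Sum>a | a dvd n. real (d K (n div a)) / real (n div a) / real a)"
    proof (intro sum.cong refl)
      fix a assume "a \<in> {a. a dvd n}"
      then obtain b where "n = a * b" by (auto elim: dvdE)
      then show "real (d K (n div a)) / real n = real (d K (n div a)) / real (n div a) / real a"
        using n by simp
    qed
    finally show "real (d (Suc K) n) / real n =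
        (\<Sum>a | a dvd n. real (d K (n div a)) / real (n div a) / real a)" .
  qed simp
  also have "\<dots> = (\<Sum>a\<in>nats_le y. \<Sum>b\<in>nats_le (y / real a). real (d K b) / real b / real a)"
    by (rule sum_divisor_pairs[where F = "\<lambda>a b. real (d K b) / real b / real a"])
  finally show ?thesis by (simp add: sum_divide_distrib)
qed

text \<open>Each step in \<open>K\<close> integrates a power of the logarithm once, and the divisors
  \<open>1, ..., K\<close> accumulate to \<open>fact K\<close>. There is no error term, so the bound
  can be used at every cutoff \<open>y / s \<ge> 1\<close>.\<close>

lemma sum_d_ge:
  assumes "y \<ge> 1"
  shows "ln y ^ K / fact K \<le> (\<Sum>n\<in>nats_le y. real (d K n) / real n)"
  using assms
proof (induction K arbitrary: y)
  case 0
  have "(\<Sum>n\<in>{1}. real (d 0 n) / real n) \<le> (\<Sum>n\<in>nats_le y. real (d 0 n) / real n)"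
    using 0 by (intro sum_mono2 finite_nats_le) (auto simp: nats_le_def)
  then show ?case by (simp add: d_0)
next
  case (Suc K)
  have "ln y ^ Suc K / fact (Suc K) = ln y ^ Suc K / real (Suc K) / fact K"
    by (simp add: field_simps)
  also have "\<dots> \<le> (\<Sum>a\<in>nats_le y. ln (y / real a) ^ K / real a) / fact K"
    using ln_power_sum_ge[OF Suc.prems] by (rule divide_right_mono) simp
  also have "\<dots> = (\<Sum>a\<in>nats_le y. ln (y / real a) ^ K / fact K / real a)"
    by (simp add: sum_divide_distrib field_simps)
  also have "\<dots> \<le> (\<Sum>n\<in>nats_le y. real (d (Suc K) n) / real n)"
    unfolding sum_d_Suc
  proof (rule sum_mono, rule divide_right_mono)
    fix a assume "a \<in> nats_le y"
    then have "y / real a \<ge> 1" by (auto simp: nats_le_def)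
    then show "ln (y / real a) ^ K / fact K \<le> (\<Sum>b\<in>nats_le (y / real a). real (d K b) / real b)"
      by (rule Suc.IH)
  qed simp
  finally show ?case .
qed

lemma sum_inverse_nats_le:
  assumes "y \<ge> 1"
  shows "(\<Sum>n\<in>nats_le y. 1 / real n) \<le> 1 + ln y"
proof -
  define n where "n = nat \<lfloor>y\<rfloor>"
  have n: "n \<ge> 1" "real n \<le> y" using assms by (auto simp: n_def le_nat_iff)
  \<comment> \<open>\<open>harm n - ln n\<close> decreases from its value 1 at \<open>n = 1\<close>;
    the library sequence starts at index 0 with \<open>Suc\<close>, hence the shift.\<close>
  have "harm (Suc (n - 1)) - ln (real (Suc (n - 1))) \<le> harm (Suc 0) - ln (real (Suc 0))"
    using decseqD[OF decseq_harm_diff_ln, of 0 "n - 1"] by simp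
  then have "harm n \<le> 1 + ln (real n)" using n by (simp add: harm_def)
  also have "\<dots> \<le> 1 + ln y" using n by simp
  finally show ?thesis by (simp add: nats_le_eq n_def harm_def inverse_eq_divide)
qed

text \<open>A crude bound without the factor \<open>1 / fact K\<close>; it enters the error term,
  where the constant does not matter.\<close>

lemma sum_d_le:
  assumes "y \<ge> 1"
  shows "(\<Sum>n\<in>nats_le y. real (d K n) / real n) \<le> (1 + ln y) ^ K"
  using assms
proof (induction K arbitrary: y)
  case 0
  have "(\<Sum>n\<in>nats_le y. real (d 0 n) / real n) = (\<Sum>n\<in>nats_le y. if n = 1 then 1 else 0)"
    by (intro sum.cong) (auto simp: d_0)
  then show ?case by simp
next
  case (Suc K)
  have "(\<Sum>n\<in>nats_le y. real (d (Suc K) n) / real n) \<le> (\<Sum>a\<in>nats_le y. (1 + ln y) ^ K / real a)"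
    unfolding sum_d_Suc
  proof (rule sum_mono, rule divide_right_mono)
    fix a assume "a \<in> nats_le y"
    then have a: "y / real a \<ge> 1" "real a \<ge> 1" by (auto simp: nats_le_def)
    have "(\<Sum>b\<in>nats_le (y / real a). real (d K b) / real b) \<le> (1 + ln (y / real a)) ^ K"
      using a by (intro Suc.IH)
    also have "\<dots> \<le> (1 + ln y) ^ K"
    proof (rule power_mono)
      show "1 + ln (y / real a) \<le> 1 + ln y"
        using a Suc.prems by (simp add: ln_div)
      show "0 \<le> 1 + ln (y / real a)"
        using a by (intro add_nonneg_nonneg ln_ge_zero) auto
    qed
    finally show "(\<Sum>b\<in>nats_le (y / real a). real (d K b) / real b) \<le> (1 + ln y) ^ K" .
  qed simp
  also have "\<dots> = (1 + ln y) ^ K * (\<Sum>a\<in>nats_le y. 1 / real a)"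
    by (simp add: sum_distrib_left)
  also have "\<dots> \<le> (1 + ln y) ^ K * (1 + ln y)"
    using Suc.prems by (intro mult_left_mono sum_inverse_nats_le) auto
  finally show ?case by (simp add: mult.commute)
qed

section \<open>Triples with a given product\<close>

definition triples :: "nat \<Rightarrow> (nat \<times> nat \<times> nat) set" where
  "triples n = {(u, v, w). u * v * w = n}"

lemma triples_eq:
  assumes "n > 0"
  shows "triples n = (\<lambda>(u, v). (u, v, n div u div v)) ` (SIGMA u:{u. u dvd n}. {v. v dvd n div u})"
    (is "_ = ?R")
proof
  show "triples n \<subseteq> ?R"
  proof
    fix z assume "z \<in> triples n"
    then obtain u v w where z: "z = (u, v, w)" "n = u * v * w" by (auto simp: triples_def)
    then have pos: "u > 0" "v > 0" using assms by auto
    then have "n div u = v * w" "n div u div v = w" using z by (simp_all add: mult.assoc)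
    then have "z = (\<lambda>(u, v). (u, v, n div u div v)) (u, v)" "(u, v) \<in> (SIGMA u:{u. u dvd n}. {v. v dvd n div u})"
      using z by auto
    then show "z \<in> ?R" by blast
  qed
  show "?R \<subseteq> triples n" by (auto simp: triples_def mult.assoc)
qed

lemma finite_triples:
  assumes "n > 0"
  shows "finite (triples n)"
  unfolding triples_eq[OF assms] using assms
  by (intro finite_imageI finite_SigmaI) (auto elim!: dvdE)

text \<open>Two applications of \<open>d_add\<close> merge a threefold convolution. Sums over
  regions \<open>u * v * w \<le> y\<close> thereby become sums of a single divisor function.\<close>

lemma sum_triples:
  assumes n: "n > 0"
  shows "(\<Sum>(u, v, w)\<in>triples n. d i u * d j v * d k w) = d (i + j + k) n"
proof -
  have pos: "n div u > 0" if "u dvd n" for u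
    using that n by (auto elim!: dvdE)
  have inj: "inj_on (\<lambda>(u, v). (u, v, n div u div v)) (SIGMA u:{u. u dvd n}. {v. v dvd n div u})"
    by (auto simp: inj_on_def)
  have "(\<Sum>(u, v, w)\<in>triples n. d i u * d j v * d k w) =
      (\<Sum>(u, v)\<in>(SIGMA u:{u. u dvd n}. {v. v dvd n div u}). d i u * d j v * d k (n div u div v))"
    unfolding triples_eq[OF n] by (subst sum.reindex[OF inj]) (simp add: case_prod_unfold comp_def)
  also have "\<dots> = (\<Sum>u | u dvd n. \<Sum>v | v dvd n div u. d i u * d j v * d k (n div u div v))"
    using n pos by (subst sum.Sigma) auto
  also have "\<dots> = (\<Sum>u | u dvd n. d i u * d (j + k) (n div u))"
  proof (rule sum.cong)
    fix u assume "u \<in> {u. u dvd n}"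
    then show "(\<Sum>v | v dvd n div u. d i u * d j v * d k (n div u div v)) = d i u * d (j + k) (n div u)"
      using d_add[OF pos, of u j k] by (simp add: sum_distrib_left mult.assoc)
  qed simp
  also have "\<dots> = d (i + j + k) n"
    using d_add[OF n, of i "j + k"] by (simp add: add.assoc)
  finally show ?thesis .
qed

section \<open>Squarefree numbers prime to a set of primes\<close>

lemma summable_power_times_geometric:
  fixes q :: real
  assumes "0 < q" "q < 1"
  shows "summable (\<lambda>j. real (j + 1) ^ K * q ^ j)"
proof -
  \<comment> \<open>The midpoint of \<open>q\<close> and 1 leaves room for the ratios of consecutive
    terms, which tend to \<open>q\<close>.\<close>
  define c where "c = (1 + q) / 2"
  have c: "q < c" "c < 1" using assms by (auto simp: c_def)
  have "(\<lambda>j. real (j + 2) / real (j + 1)) \<longlonglongrightarrow> 1" by real_asymp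
  then have "(\<lambda>j. (real (j + 2) / real (j + 1)) ^ K * q) \<longlonglongrightarrow> 1 ^ K * q"
    by (intro tendsto_intros)
  then have "eventually (\<lambda>j. (real (j + 2) / real (j + 1)) ^ K * q < c) sequentially"
    using c by (intro order_tendstoD) auto
  then obtain N where N: "\<And>j. j \<ge> N \<Longrightarrow> (real (j + 2) / real (j + 1)) ^ K * q < c"
    by (auto simp: eventually_sequentially)
  show ?thesis
  proof (rule summable_ratio_test[OF c(2)])
    fix j assume "j \<ge> N"
    have "real (Suc j + 1) ^ K * q ^ Suc j = (real (j + 2) / real (j + 1)) ^ K * q * (real (j + 1) ^ K * q ^ j)"
      by (simp add: power_divide)
    also have "\<dots> \<le> c * (real (j + 1) ^ K * q ^ j)"
      using N[OF \<open>j \<ge> N\<close>] assms by (intro mult_right_mono) auto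
    finally show "norm (real (Suc j + 1) ^ K * q ^ Suc j) \<le> c * norm (real (j + 1) ^ K * q ^ j)"
      using assms by simp
  qed
qed

text \<open>Taken at \<open>q = 1 / 2\<close> for powers of a single prime, and at the cube root of
  \<open>1 / 2\<close> for triples of exponents.\<close>

definition power_series_bound :: "nat \<Rightarrow> real \<Rightarrow> real" where
  "power_series_bound K q = (\<Sum>j. real (j + 1) ^ K * q ^ j)"

lemma sum_le_power_series_bound:
  assumes "0 < q" "q < 1" "finite J"
  shows "(\<Sum>j\<in>J. real (j + 1) ^ K * q ^ j) \<le> power_series_bound K q"
  unfolding power_series_bound_def
  using assms by (intro sum_le_suminf summable_power_times_geometric) auto

lemma power_series_bound_nonneg:
  assumes "0 < q" "q < 1"
  shows "power_series_bound K q \<ge> 0"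
  using sum_le_power_series_bound[OF assms, of "{}"] by simp

text \<open>Leaving out the exponent 1 removes the term of order \<open>1 / p\<close>. From exponent
  2 on, \<open>p ^ (i + 2)\<close> is at least \<open>p ^ 2 * 2 ^ i\<close>, and the factor 4
  rewrites \<open>2 ^ i\<close> in terms of \<open>j = i + 2\<close>.\<close>

lemma sum_d_prime_power_tail:
  assumes p: "prime p" and J: "finite J" "0 \<in> J" "1 \<notin> J"
  shows "(\<Sum>j\<in>J. real (d K (p ^ j)) / real (p ^ j)) \<le> 1 + 4 * power_series_bound K (1 / 2) / real p ^ 2"
proof -
  have p2: "real p \<ge> 2" using prime_ge_2_nat[OF p] by simp
  have "d K 1 = 1" by (rule d_one_right)
  then have "(\<Sum>j\<in>J. real (d K (p ^ j)) / real (p ^ j)) = 1 + (\<Sum>j\<in>J - {0}. real (d K (p ^ j)) / real (p ^ j))"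
    using J by (subst sum.remove[of J 0]) auto
  also have "(\<Sum>j\<in>J - {0}. real (d K (p ^ j)) / real (p ^ j)) \<le>
      (\<Sum>j\<in>J - {0}. 4 / real p ^ 2 * (real (j + 1) ^ K * (1 / 2) ^ j))"
  proof (rule sum_mono)
    fix j assume "j \<in> J - {0}"
    then have "j \<ge> 2" using J by (cases "j = 1") auto
    then obtain i where j: "j = i + 2" by (metis add.commute le_Suc_ex)
    have "real (d K (p ^ j)) \<le> real (j + 1) ^ K"
      using d_prime_power_le[OF p, of K j] of_nat_mono by fastforce
    then have "real (d K (p ^ j)) / real (p ^ j) \<le> real (j + 1) ^ K / (real p ^ 2 * 2 ^ i)"
      using p2 unfolding j power_add of_nat_mult of_nat_power
      by (intro frac_le) (auto intro!: mult_mono power_mono simp: mult.commute)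
    then show "real (d K (p ^ j)) / real (p ^ j) \<le> 4 / real p ^ 2 * (real (j + 1) ^ K * (1 / 2) ^ j)"
      by (simp add: j power_one_over field_simps)
  qed
  also have "\<dots> \<le> 4 / real p ^ 2 * power_series_bound K (1 / 2)"
    unfolding sum_distrib_left[symmetric] using J
    by (intro mult_left_mono sum_le_power_series_bound) auto
  finally show ?thesis by simp
qed

lemma sum_d_prime_power_le:
  assumes p: "prime p" and J: "finite J"
  shows "(\<Sum>j\<in>J. real (d K (p ^ j)) / real (p ^ j)) \<le> (1 / (1 - 1 / real p)) ^ K"
proof -
  have "(\<Sum>j\<in>J. real (d K (p ^ j)) / real p ^ j) \<le> (\<Sum>j. real (d K (p ^ j)) / real p ^ j)"
    using d_prime_power_sums[OF p, of K] J by (intro sum_le_suminf) (auto simp: sums_iff)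
  then show ?thesis
    using d_prime_power_sums[OF p, of K] by (simp add: sums_iff)
qed

section \<open>Splitting off the squarefree cofactor\<close>

definition free_of :: "nat set \<Rightarrow> nat \<Rightarrow> bool" where
  "free_of B r \<longleftrightarrow> squarefree r \<and> (\<forall>p\<in>B. \<not> p dvd r)"

text \<open>Split \<open>n\<close> as \<open>b * r\<close>, where \<open>r\<close> is the product of the primes outside \<open>B\<close> that divide \<open>n\<close>
  exactly once.\<close>

lemma sum_d_le_prod_mult_sum_free:
  fixes y :: real and K :: nat and B :: "nat set"
  defines "M \<equiv> nat \<lfloor>y\<rfloor>"
  defines "J \<equiv> (\<lambda>p. if p \<in> B then {..M} else {..M} - {1})"
  assumes "\<And>p. p \<in> B \<Longrightarrow> prime p"
  shows "(\<Sum>n\<in>nats_le y. real (d K n) / real n) \<le>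
    (\<Prod>p | prime p \<and> p \<le> M. \<Sum>j\<in>J p. real (d K (p ^ j)) / real (p ^ j)) *
    (\<Sum>r | r \<in> nats_le y \<and> free_of B r. real (d K r) / real r)"
proof -
  define P where "P = {p::nat. prime p \<and> p \<le> M}"
  define F where "F n = real (d K n) / real n" for n
  \<comment> \<open>\<open>sg n p\<close> marks the primes that go into the cofactor
    \<open>gd n\<close>. The remaining exponents form \<open>bad n\<close>, restricted to
    \<open>P\<close> so that it is a point of \<open>PiE P J\<close>.\<close>
  define sg where "sg n p = (p \<notin> B \<and> multiplicity p n = 1)" for n p
  define bad where "bad n = restrict (\<lambda>p. if sg n p then 0 else multiplicity p n) P" for n
  define gx where "gx n p = (if sg n p then 1 else 0 :: nat)" for n p
  define gd where "gd n = (\<Prod>p\<in>P. p ^ gx n p)" for n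
  have finP: "finite P" and prP: "\<And>p. p \<in> P \<Longrightarrow> prime p" by (auto simp: P_def)
  have d1: "d K 1 = 1" by (rule d_one_right)
  have F0: "F n \<ge> 0" for n by (simp add: F_def)
  have Fprod: "F (\<Prod>p\<in>P. p ^ e p) = (\<Prod>p\<in>P. F (p ^ e p))" for e
    using d_prod_prime_powers[OF finP prP, of K e] by (simp add: F_def prod_dividef)
  have nprod: "n = (\<Prod>p\<in>P. p ^ multiplicity p n)" if "n \<in> nats_le y" for n
  proof -
    have n: "n > 0" "n \<le> M" using that by (auto simp: nats_le_eq M_def)
    have "prime_factors n \<subseteq> P"
      using n by (auto simp: P_def in_prime_factors_iff) (meson dvd_imp_le le_trans)
    then have "(\<Prod>p\<in>prime_factors n. p ^ multiplicity p n) = (\<Prod>p\<in>P. p ^ multiplicity p n)"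
      using finP prP n by (intro prod.mono_neutral_left)
        (auto simp: in_prime_factors_iff not_dvd_imp_multiplicity_0)
    then show ?thesis using prime_factorization_nat[OF n(1)] by simp
  qed
  have mult_eq: "p ^ multiplicity p n = p ^ bad n p * p ^ gx n p" if "p \<in> P" for p n
    using that by (simp add: bad_def gx_def sg_def)
  have split: "n = (\<Prod>p\<in>P. p ^ bad n p) * gd n" if "n \<in> nats_le y" for n
    using nprod[OF that] mult_eq by (simp add: gd_def prod.distrib[symmetric])
  have Fsplit: "F n = (\<Prod>p\<in>P. F (p ^ bad n p)) * F (gd n)" if n: "n \<in> nats_le y" for n
  proof -
    have "F n = (\<Prod>p\<in>P. F (p ^ multiplicity p n))"
      using nprod[OF n] Fprod by metis
    also have "\<dots> = (\<Prod>p\<in>P. F (p ^ bad n p) * F (p ^ gx n p))"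
      using d1 by (intro prod.cong) (auto simp: bad_def gx_def sg_def F_def)
    finally show ?thesis by (simp add: prod.distrib gd_def Fprod)
  qed
  have gd_free: "free_of B (gd n)" for n
    unfolding free_of_def
  proof
    show "squarefree (gd n)"
      unfolding gd_def
    proof (rule squarefree_prod_coprime)
      fix p q assume "p \<in> P" "q \<in> P" "p \<noteq> q"
      then show "coprime (p ^ gx n p) (q ^ gx n q)"
        by (simp add: primes_coprime prP)
    next
      fix p assume "p \<in> P"
      then show "squarefree (p ^ gx n p)" by (auto simp: gx_def squarefree_prime prP)
    qed
    show "\<forall>p\<in>B. \<not> p dvd gd n"
    proof (intro ballI notI)
      fix p assume p: "p \<in> B" "p dvd gd n"
      have "prime p" using p assms by blast
      then obtain q where q: "q \<in> P" "p dvd q ^ gx n q"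
        using p(2) finP unfolding gd_def by (auto simp: prime_dvd_prod_iff)
      then have "p dvd q" "sg n q" using \<open>prime p\<close> by (auto simp: gx_def split: if_splits)
      then have "p = q" using prP[OF q(1)] \<open>prime p\<close> primes_dvd_imp_eq by blast
      then show False using \<open>sg n q\<close> p by (simp add: sg_def)
    qed
  qed
  \<comment> \<open>The image lies in a full product set. Since all terms are nonnegative, the sum
    may be enlarged to that set, where it factors over the primes.\<close>
  have maps: "(\<lambda>n. (bad n, gd n)) ` nats_le y \<subseteq> PiE P J \<times> {r \<in> nats_le y. free_of B r}"
  proof clarify
    fix n assume n: "n \<in> nats_le y"
    have n': "n > 0" "n \<le> M" using n by (auto simp: nats_le_eq M_def)
    have "multiplicity p n \<le> M" if "p \<in> P" for p
    proof -
      have "p ^ multiplicity p n \<le> n" using n' by (intro dvd_imp_le multiplicity_dvd) auto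
      moreover have "2 ^ multiplicity p n \<le> p ^ multiplicity p n"
        using prP[OF that] by (intro power_mono prime_ge_2_nat) auto
      moreover have "multiplicity p n < 2 ^ multiplicity p n" by (rule less_exp)
      ultimately show ?thesis using n'(2) by linarith
    qed
    then have "bad n \<in> PiE P J" by (auto simp: bad_def J_def sg_def)
    moreover have "gd n dvd n" using split[OF n] by (metis dvd_triv_right)
    then have "gd n > 0" "gd n \<le> n" using n' by (auto intro: Nat.gr0I dvd_imp_le)
    then have "gd n \<in> nats_le y" using n' by (simp add: nats_le_eq M_def)
    ultimately show "bad n \<in> PiE P J \<and> gd n \<in> {r \<in> nats_le y. free_of B r}"
      using gd_free by simp
  qed
  have inj: "inj_on (\<lambda>n. (bad n, gd n)) (nats_le y)"
  proof (rule inj_onI)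
    fix a b assume ab: "a \<in> nats_le y" "b \<in> nats_le y" "(bad a, gd a) = (bad b, gd b)"
    have "a = (\<Prod>p\<in>P. p ^ bad a p) * gd a" by (rule split[OF ab(1)])
    also have "\<dots> = (\<Prod>p\<in>P. p ^ bad b p) * gd b" using ab(3) by simp
    also have "\<dots> = b" by (rule split[OF ab(2), symmetric])
    finally show "a = b" .
  qed
  have "(\<Sum>n\<in>nats_le y. F n) = (\<Sum>n\<in>nats_le y. (\<lambda>(b, r). (\<Prod>p\<in>P. F (p ^ b p)) * F r) (bad n, gd n))"
    by (intro sum.cong) (simp_all add: Fsplit)
  also have "\<dots> = (\<Sum>(b, r)\<in>(\<lambda>n. (bad n, gd n)) ` nats_le y. (\<Prod>p\<in>P. F (p ^ b p)) * F r)"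
    by (subst sum.reindex[OF inj]) (simp add: comp_def)
  also have "\<dots> \<le> (\<Sum>(b, r)\<in>PiE P J \<times> {r \<in> nats_le y. free_of B r}. (\<Prod>p\<in>P. F (p ^ b p)) * F r)"
    using maps finP by (intro sum_mono2 finite_cartesian_product finite_PiE)
      (auto simp: J_def intro!: mult_nonneg_nonneg prod_nonneg F0)
  also have "\<dots> = (\<Sum>b\<in>PiE P J. \<Prod>p\<in>P. F (p ^ b p)) * (\<Sum>r | r \<in> nats_le y \<and> free_of B r. F r)"
    by (simp add: sum_product sum.cartesian_product)
  also have "(\<Sum>b\<in>PiE P J. \<Prod>p\<in>P. F (p ^ b p)) = (\<Prod>p\<in>P. \<Sum>j\<in>J p. F (p ^ j))"
    using finP by (subst prod_sum_PiE) (auto simp: J_def)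
  finally show ?thesis by (simp add: F_def P_def)
qed

text \<open>Telescoping, since \<open>1 / (M + 1) ^ 2\<close> is at most
  \<open>1 / M - 1 / (M + 1)\<close>.\<close>

lemma sum_inverse_squares_le:
  assumes "z \<ge> 1"
  shows "(\<Sum>n\<in>{z<..M}. 1 / real n ^ 2) \<le> 1 / real z"
proof (cases "M \<ge> z")
  case True
  then have "(\<Sum>n\<in>{z<..M}. 1 / real n ^ 2) \<le> 1 / real z - 1 / real M"
  proof (induction M rule: dec_induct)
    case (step M)
    have "{z<..Suc M} = insert (Suc M) {z<..M}" using step by auto
    moreover have "1 / real (Suc M) ^ 2 \<le> 1 / real M - 1 / real (Suc M)"
    proof -
      have "1 / real M - 1 / real (Suc M) = 1 / (real M * real (Suc M))"
        using step assms by (simp add: field_simps)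
      moreover have "real M * real (Suc M) \<le> real (Suc M) ^ 2"
        by (simp add: power2_eq_square)
      ultimately show ?thesis using step assms by (simp add: frac_le del: of_nat_Suc)
    qed
    ultimately show ?case using step.IH by simp
  qed simp
  then show ?thesis by (smt (verit) divide_nonneg_nonneg of_nat_0_le_iff)
qed simp

text \<open>The full sum is bounded below by \<open>sum_d_ge\<close>, and the part split off from
  the cofactor can contribute at most a full Euler factor for each prime of \<open>B\<close> and
  \<open>1 + C / p ^ 2\<close> for every other prime. The latter primes all exceed \<open>z\<close>,
  so together they cost at most \<open>exp (C / z)\<close>.\<close>

lemma sum_free_of_ge:
  fixes y :: real and z :: nat
  assumes y: "y \<ge> 1" and B: "finite B" "\<And>p. p \<in> B \<Longrightarrow> prime p"
    and z: "z \<ge> 1" "\<And>p. prime p \<Longrightarrow> p \<le> z \<Longrightarrow> p \<in> B"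
  shows "ln y ^ K / fact K \<le>
    (\<Prod>p\<in>B. (1 / (1 - 1 / real p)) ^ K) * exp (4 * power_series_bound K (1 / 2) / real z) *
    (\<Sum>r | r \<in> nats_le y \<and> free_of B r. real (d K r) / real r)"
proof -
  define M where "M = nat \<lfloor>y\<rfloor>"
  define J where "J = (\<lambda>p. if p \<in> B then {..M} else {..M} - {1})"
  define P where "P = {p::nat. prime p \<and> p \<le> M}"
  define E where "E p = (\<Sum>j\<in>J p. real (d K (p ^ j)) / real (p ^ j))" for p
  define C where "C = 4 * power_series_bound K (1 / 2)"
  have C0: "C \<ge> 0" unfolding C_def by (intro mult_nonneg_nonneg power_series_bound_nonneg) auto
  have finP: "finite P" by (simp add: P_def)
  have E0: "E p \<ge> 0" for p by (auto simp: E_def intro!: sum_nonneg)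
  have one_le: "1 \<le> (1 / (1 - 1 / real p)) ^ K" if "p \<in> B" for p
    using prime_gt_1_nat[OF B(2)[OF that]] by (intro one_le_power) (simp add: field_simps)
  have nonneg: "0 \<le> (1 / (1 - 1 / real p)) ^ K" if "p \<in> B" for p
    using one_le[OF that] by simp
  have "(\<Prod>p\<in>P \<inter> B. E p) \<le> (\<Prod>p\<in>P \<inter> B. (1 / (1 - 1 / real p)) ^ K)"
  proof (intro prod_mono conjI E0)
    fix p assume "p \<in> P \<inter> B"
    then show "E p \<le> (1 / (1 - 1 / real p)) ^ K"
      unfolding E_def by (intro sum_d_prime_power_le) (auto simp: J_def P_def)
  qed
  \<comment> \<open>Each Euler factor is at least 1, so the primes of \<open>B\<close> beyond
    \<open>M\<close> may be included.\<close>
  also have "\<dots> \<le> (\<Prod>p\<in>B. (1 / (1 - 1 / real p)) ^ K)"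
    using B one_le nonneg by (intro prod_mono2) auto
  finally have PB: "(\<Prod>p\<in>P \<inter> B. E p) \<le> (\<Prod>p\<in>B. (1 / (1 - 1 / real p)) ^ K)" .
  have "(\<Prod>p\<in>P - B. E p) \<le> (\<Prod>p\<in>P - B. exp (C / real p ^ 2))"
  proof (rule prod_mono, intro conjI E0)
    fix p assume p: "p \<in> P - B"
    then have "prime p" "p \<le> M" by (auto simp: P_def)
    then have "E p \<le> 1 + C / real p ^ 2"
      using p unfolding E_def C_def J_def by (intro sum_d_prime_power_tail) auto
    also have "\<dots> \<le> exp (C / real p ^ 2)" by (rule exp_ge_add_one_self)
    finally show "E p \<le> exp (C / real p ^ 2)" .
  qed
  also have "\<dots> = exp (\<Sum>p\<in>P - B. C / real p ^ 2)" using finP by (simp add: exp_sum)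
  also have "(\<Sum>p\<in>P - B. C / real p ^ 2) \<le> (\<Sum>p\<in>{z<..M}. C / real p ^ 2)"
    using z C0 by (intro sum_mono2) (auto simp: P_def not_le[symmetric])
  also have "\<dots> = C * (\<Sum>p\<in>{z<..M}. 1 / real p ^ 2)" by (simp add: sum_distrib_left)
  also have "\<dots> \<le> C * (1 / real z)"
    using sum_inverse_squares_le[OF z(1)] C0 by (rule mult_left_mono)
  finally have PC: "(\<Prod>p\<in>P - B. E p) \<le> exp (C / real z)" by simp
  have "(\<Prod>p\<in>P. E p) = (\<Prod>p\<in>P \<inter> B. E p) * (\<Prod>p\<in>P - B. E p)"
    using finP by (metis prod.Int_Diff)
  also have "\<dots> \<le> (\<Prod>p\<in>B. (1 / (1 - 1 / real p)) ^ K) * exp (C / real z)"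
    using PB PC E0 nonneg by (intro mult_mono prod_nonneg) auto
  finally have PP: "(\<Prod>p\<in>P. E p) \<le> (\<Prod>p\<in>B. (1 / (1 - 1 / real p)) ^ K) * exp (C / real z)" .
  have "ln y ^ K / fact K \<le> (\<Sum>n\<in>nats_le y. real (d K n) / real n)"
    by (rule sum_d_ge[OF y])
  also have "\<dots> \<le> (\<Prod>p\<in>P. E p) * (\<Sum>r | r \<in> nats_le y \<and> free_of B r. real (d K r) / real r)"
    unfolding P_def E_def J_def M_def using B(2) by (rule sum_d_le_prod_mult_sum_free)
  also have "\<dots> \<le> (\<Prod>p\<in>B. (1 / (1 - 1 / real p)) ^ K) * exp (C / real z) *
      (\<Sum>r | r \<in> nats_le y \<and> free_of B r. real (d K r) / real r)"
    using PP by (rule mult_right_mono) (auto intro!: sum_nonneg)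
  finally show ?thesis by (simp add: C_def)
qed

section \<open>Solutions of the congruences\<close>

lemma g_eq_1_iff:
  "g h u v w = 1 \<longleftrightarrow> (\<exists>n::int. int u dvd n + int h \<and> int v dvd n \<and> int w dvd n - int h)"
  by (auto simp: g_def cong_iff_dvd_diff)

lemma g_cases: "g h u v w = 0 \<or> g h u v w = 1"
  by (simp add: g_def)

text \<open>The Chinese remainder theorem merges solutions of the two systems into one
  \<open>n\<close>. Coprimality of \<open>u\<close> and \<open>u'\<close>, and likewise of the other
  pairs, then combines the divisibilities into one by the product.\<close>

lemma g_mult:
  assumes cop: "coprime (u * v * w) (u' * v' * w')" and "g h u v w = 1" "g h u' v' w' = 1"
  shows "g h (u * u') (v * v') (w * w') = 1"
proof -
  obtain n1 n2 where n1: "int u dvd n1 + int h" "int v dvd n1" "int w dvd n1 - int h"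
    and n2: "int u' dvd n2 + int h" "int v' dvd n2" "int w' dvd n2 - int h"
    using assms by (auto simp: g_eq_1_iff)
  have "coprime (int (u * v * w)) (int (u' * v' * w'))"
    using cop by (simp only: coprime_int_iff)
  then obtain n where "[n = n1] (mod int (u * v * w))" "[n = n2] (mod int (u' * v' * w'))"
    using binary_chinese_remainder_int by blast
  then have n: "int (u * v * w) dvd n - n1" "int (u' * v' * w') dvd n - n2"
    by (simp_all add: cong_iff_dvd_diff)
  have "int u dvd n - n1" "int v dvd n - n1" "int w dvd n - n1"
    using n(1) by (auto elim: dvd_trans[rotated])
  moreover have "int u' dvd n - n2" "int v' dvd n - n2" "int w' dvd n - n2"
    using n(2) by (auto elim: dvd_trans[rotated])
  ultimately have dvd: "int u dvd n + int h" "int v dvd n" "int w dvd n - int h"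
    "int u' dvd n + int h" "int v' dvd n" "int w' dvd n - int h"
    using dvd_add[of "int u" "n - n1" "n1 + int h"] dvd_add[of "int v" "n - n1" n1]
      dvd_add[of "int w" "n - n1" "n1 - int h"] dvd_add[of "int u'" "n - n2" "n2 + int h"]
      dvd_add[of "int v'" "n - n2" n2] dvd_add[of "int w'" "n - n2" "n2 - int h"] n1 n2
    by (simp_all add: algebra_simps)
  have "coprime (int u) (int u')" "coprime (int v) (int v')" "coprime (int w) (int w')"
    using cop by (auto simp: coprime_int_iff)
  then show ?thesis
    unfolding g_eq_1_iff of_nat_mult using dvd by (blast intro: divides_mult)
qed

text \<open>A solution \<open>n0\<close> brings along its whole residue class modulo the common
  multiple \<open>q\<close>, and this class meets every block of \<open>q\<close> consecutive
  integers in \<open>h < n \<le> x\<close>.\<close>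

lemma card_solutions_ge:
  fixes x :: real
  assumes g: "g h u v w = 1" and q: "q > 0" "u dvd q" "v dvd q" "w dvd q" and h: "real h \<le> x"
  shows "(x - real h) / real q - 1 \<le>
    real (card {n. h < n \<and> real n \<le> x \<and> u dvd n + h \<and> v dvd n \<and> w dvd n - h})"
    (is "_ \<le> real (card ?S)")
proof -
  obtain n0 where n0: "int u dvd n0 + int h" "int v dvd n0" "int w dvd n0 - int h"
    using g by (auto simp: g_eq_1_iff)
  \<comment> \<open>Chosen so that \<open>h + 1 + r\<close> is the least member of the class of
    \<open>n0\<close> above \<open>h\<close>.\<close>
  define r where "r = nat ((n0 - int h - 1) mod int q)"
  \<comment> \<open>The number of complete blocks of length \<open>q\<close>; as
    \<open>1 + r \<le> q\<close>, the \<open>i\<close>-th solution \<open>f i\<close> stays within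
    block \<open>i\<close>.\<close>
  define t where "t = nat \<lfloor>(x - real h) / real q\<rfloor>"
  define f where "f i = h + 1 + r + q * i" for i
  have r: "r < q" "int r = (n0 - int h - 1) mod int q" using q by (auto simp: r_def nat_less_iff)
  have f_cong: "int q dvd int (f i) - n0" for i
  proof -
    have "int q dvd (n0 - int h - 1) mod int q - (n0 - int h - 1)"
      by (simp add: mod_eq_dvd_iff[symmetric])
    then have "int q dvd ((n0 - int h - 1) mod int q - (n0 - int h - 1)) + int q * int i"
      by (intro dvd_add) auto
    then show ?thesis by (simp add: f_def r(2) algebra_simps)
  qed
  have "f ` {..<t} \<subseteq> ?S"
  proof (rule image_subsetI)
    fix i assume i: "i \<in> {..<t}"
    have "int (i + 1) \<le> \<lfloor>(x - real h) / real q\<rfloor>" using i by (auto simp: t_def)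
    then have "real (i + 1) \<le> (x - real h) / real q" by (simp add: le_floor_iff)
    then have "real q * real (i + 1) \<le> x - real h"
      using q by (simp add: pos_le_divide_eq mult.commute)
    moreover have "real (1 + r) \<le> real q" using r(1) by linarith
    ultimately have le: "real (f i) \<le> x" by (simp add: f_def algebra_simps)
    have gt: "h < f i" by (simp add: f_def)
    have "int u dvd int (f i) - n0" "int v dvd int (f i) - n0" "int w dvd int (f i) - n0"
      using f_cong[of i] q(2-4) by (meson dvd_trans of_nat_dvd_iff)+
    then have "int u dvd int (f i) + int h" "int v dvd int (f i)" "int w dvd int (f i) - int h"
      using n0 dvd_add[of "int u" "int (f i) - n0" "n0 + int h"] dvd_add[of "int v" "int (f i) - n0" n0]
        dvd_add[of "int w" "int (f i) - n0" "n0 - int h"] by (simp_all add: algebra_simps)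
    then have "int u dvd int (f i + h)" "int v dvd int (f i)" "int w dvd int (f i - h)"
      using gt by (simp_all add: of_nat_diff)
    then show "f i \<in> ?S"
      using le gt by (simp only: of_nat_dvd_iff mem_Collect_eq simp_thms)
  qed
  moreover have "finite ?S"
    by (rule finite_subset[OF _ finite_nats_le[of x]]) (auto simp: nats_le_def)
  ultimately have "card (f ` {..<t}) \<le> card ?S" by (intro card_mono)
  moreover have "card (f ` {..<t}) = t"
    using q(1) by (subst card_image) (auto simp: inj_on_def f_def)
  moreover have "(x - real h) / real q - 1 \<le> real t" unfolding t_def by linarith
  ultimately show ?thesis by linarith
qed

section \<open>From the correlation sum to densities of solutions\<close>

text \<open>Each of the three divisor functions is opened with \<open>d_Suc\<close>, the order of
  summation is exchanged, and divisor triples outside \<open>Tr\<close> are discarded, which is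
  allowed because all weights are nonnegative.\<close>

lemma T_ge_card:
  assumes "k \<ge> 1" "l \<ge> 1" "m \<ge> 1" and Tr: "finite Tr"
  shows "(\<Sum>(u, v, w)\<in>Tr. real (d (k - 1) u * d (l - 1) v * d (m - 1) w) *
      real (card {n. h < n \<and> real n \<le> x \<and> u dvd n + h \<and> v dvd n \<and> w dvd n - h})) \<le> T k l m x h"
proof -
  \<comment> \<open>For \<open>n > h\<close> the truncated difference \<open>n - h\<close> is
    positive, so that \<open>d_Suc\<close> applies and the divisor sets are finite.\<close>
  define N where "N = {n. h < n \<and> real n \<le> x}"
  have finN: "finite N"
    by (rule finite_subset[OF _ finite_nats_le[of x]]) (auto simp: nats_le_def N_def)
  define D where "D n = {u. u dvd n + h} \<times> {v. v dvd n} \<times> {w. w dvd n - h}" for n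
  have finD: "finite (D n)" if "n \<in> N" for n
    using that by (auto simp: D_def N_def)
  define W where "W = (\<lambda>(u, v, w). real (d (k - 1) u * d (l - 1) v * d (m - 1) w))"
  have D_eq: "real (d k (n + h) * d l n * d m (n - h)) = (\<Sum>t\<in>D n. W t)" if n: "n \<in> N" for n
  proof -
    have "n + h > 0" "n > 0" "n - h > 0" using n by (auto simp: N_def)
    then have "d k (n + h) = (\<Sum>u | u dvd n + h. d (k - 1) u)" "d l n = (\<Sum>v | v dvd n. d (l - 1) v)"
      "d m (n - h) = (\<Sum>w | w dvd n - h. d (m - 1) w)"
      using assms d_Suc[of _ "k - 1"] d_Suc[of _ "l - 1"] d_Suc[of _ "m - 1"] by simp_all
    then have "d k (n + h) * d l n * d m (n - h) =
        (\<Sum>u | u dvd n + h. \<Sum>v | v dvd n. \<Sum>w | w dvd n - h. d (k - 1) u * d (l - 1) v * d (m - 1) w)"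
      by (simp add: sum_distrib_left[symmetric] sum_distrib_right[symmetric] mult.assoc)
    also have "\<dots> = (\<Sum>(u, v, w)\<in>D n. d (k - 1) u * d (l - 1) v * d (m - 1) w)"
      by (simp add: D_def sum.cartesian_product case_prod_unfold)
    finally show ?thesis by (simp add: W_def case_prod_unfold)
  qed
  have W0: "W t \<ge> 0" for t by (simp add: W_def case_prod_unfold)
  have "(\<Sum>(u, v, w)\<in>Tr. real (d (k - 1) u * d (l - 1) v * d (m - 1) w) *
      real (card {n. h < n \<and> real n \<le> x \<and> u dvd n + h \<and> v dvd n \<and> w dvd n - h})) =
      (\<Sum>t\<in>Tr. W t * real (card {n\<in>N. t \<in> D n}))"
    by (intro sum.cong) (auto simp: W_def N_def D_def)
  also have "\<dots> = (\<Sum>t\<in>Tr. \<Sum>n\<in>N. if t \<in> D n then W t else 0)"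
    using finN by (simp add: sum.If_cases Int_def mult.commute)
  also have "\<dots> = (\<Sum>n\<in>N. \<Sum>t\<in>Tr. if t \<in> D n then W t else 0)"
    by (rule sum.swap)
  also have "\<dots> \<le> (\<Sum>n\<in>N. \<Sum>t\<in>D n. W t)"
  proof (rule sum_mono)
    fix n assume n: "n \<in> N"
    have "(\<Sum>t\<in>Tr. if t \<in> D n then W t else 0) = (\<Sum>t\<in>Tr \<inter> D n. W t)"
      using Tr by (simp add: sum.inter_restrict)
    also have "\<dots> \<le> (\<Sum>t\<in>D n. W t)"
      using finD[OF n] W0 by (intro sum_mono2) auto
    finally show "(\<Sum>t\<in>Tr. if t \<in> D n then W t else 0) \<le> (\<Sum>t\<in>D n. W t)" .
  qed
  also have "\<dots> = (\<Sum>n\<in>N. real (d k (n + h) * d l n * d m (n - h)))"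
    by (intro sum.cong refl D_eq[symmetric])
  also have "\<dots> \<le> T k l m x h"
    unfolding T_def
  proof (rule sum_mono2)
    show "finite {n. 1 \<le> n \<and> real n \<le> x}"
      using finite_nats_le[of x] by (simp add: nats_le_def)
  qed (auto simp: N_def)
  finally show ?thesis .
qed

definition weight :: "nat \<Rightarrow> nat \<Rightarrow> nat \<Rightarrow> nat \<times> nat \<times> nat \<Rightarrow> nat" where
  "weight k l m = (\<lambda>(u, v, w). d (k - 1) u * d (l - 1) v * d (m - 1) w)"

text \<open>The natural density of the solutions of the congruences: if there are any, they form one
  residue class modulo the lcm.\<close>

definition sol_density :: "nat \<Rightarrow> nat \<times> nat \<times> nat \<Rightarrow> real" where
  "sol_density h = (\<lambda>(u, v, w). g h u v w / real (lcm u (lcm v w)))"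

text \<open>The product is cut off, rather than each variable separately, so that sums regroup by
  \<open>n = u * v * w\<close>.\<close>

definition triples_le :: "real \<Rightarrow> (nat \<times> nat \<times> nat) set" where
  "triples_le y = {(u, v, w). u * v * w \<in> nats_le y}"

lemma sum_triples_le:
  fixes H :: "nat \<times> nat \<times> nat \<Rightarrow> real"
  shows "(\<Sum>t\<in>triples_le y. H t) = (\<Sum>n\<in>nats_le y. \<Sum>t\<in>triples n. H t)"
proof -
  have "triples_le y = (\<Union>n\<in>nats_le y. triples n)"
    by (auto simp: triples_le_def triples_def)
  moreover have "finite (triples n)" if "n \<in> nats_le y" for n
    using that by (intro finite_triples) (simp add: nats_le_def)
  ultimately show ?thesis
    using sum.UNION_disjoint[of "nats_le y" triples H] by (auto simp: triples_def)
qed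

lemma finite_triples_le: "finite (triples_le y)"
proof -
  have "triples_le y = (\<Union>n\<in>nats_le y. triples n)"
    by (auto simp: triples_le_def triples_def)
  moreover have "finite (triples n)" if "n \<in> nats_le y" for n
    using that by (intro finite_triples) (simp add: nats_le_def)
  ultimately show ?thesis by simp
qed

text \<open>Bounds the total rounding loss from counting solutions. Grouping by the product gives
  \<open>d K n\<close>, and inserting \<open>1 \<le> y / n\<close> reduces to the logarithmic
  sum.\<close>

lemma sum_weight_triples_le:
  assumes "y \<ge> 1" "k \<ge> 1" "l \<ge> 1" "m \<ge> 1"
  shows "(\<Sum>t\<in>triples_le y. real (weight k l m t)) \<le> y * (1 + ln y) ^ (k + l + m - 3)"
proof -
  define K where "K = k + l + m - 3"
  have "(\<Sum>t\<in>triples_le y. real (weight k l m t)) = (\<Sum>n\<in>nats_le y. \<Sum>t\<in>triples n. real (weight k l m t))"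
    by (rule sum_triples_le)
  also have "\<dots> = (\<Sum>n\<in>nats_le y. real (d K n))"
  proof (rule sum.cong)
    fix n assume "n \<in> nats_le y"
    then have "n > 0" by (simp add: nats_le_def)
    moreover have "k - 1 + (l - 1) + (m - 1) = K" using assms by (simp add: K_def)
    ultimately show "(\<Sum>t\<in>triples n. real (weight k l m t)) = real (d K n)"
      using sum_triples[of n "k - 1" "l - 1" "m - 1"] by (simp add: weight_def of_nat_sum[symmetric] del: of_nat_sum)
  qed simp
  also have "\<dots> \<le> (\<Sum>n\<in>nats_le y. y * (real (d K n) / real n))"
  proof (rule sum_mono)
    fix n assume "n \<in> nats_le y"
    then have n: "real n \<ge> 1" "real n \<le> y" by (auto simp: nats_le_def)
    then have "real n * real (d K n) \<le> y * real (d K n)" by (intro mult_right_mono) auto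
    then show "real (d K n) \<le> y * (real (d K n) / real n)" using n by (simp add: field_simps)
  qed
  also have "\<dots> = y * (\<Sum>n\<in>nats_le y. real (d K n) / real n)" by (simp add: sum_distrib_left)
  also have "\<dots> \<le> y * (1 + ln y) ^ K" using assms by (intro mult_left_mono sum_d_le) auto
  finally show ?thesis by (simp add: K_def)
qed

text \<open>For each triple the number of solutions falls short of length times density by at most
  1; without solutions the left side for that triple is at most 0.\<close>

lemma T_ge_sol_density_sum:
  assumes klm: "k \<ge> 1" "l \<ge> 1" "m \<ge> 1" and h: "real h \<le> x"
  shows "(x - real h) * (\<Sum>t\<in>triples_le y. real (weight k l m t) * sol_density h t) -
      (\<Sum>t\<in>triples_le y. real (weight k l m t)) \<le> T k l m x h"
proof -
  have "(x - real h) * (\<Sum>t\<in>triples_le y. real (weight k l m t) * sol_density h t) -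
      (\<Sum>t\<in>triples_le y. real (weight k l m t)) =
      (\<Sum>t\<in>triples_le y. real (weight k l m t) * ((x - real h) * sol_density h t - 1))"
    by (simp add: sum_distrib_left sum_subtractf[symmetric] algebra_simps)
  also have "\<dots> \<le> (\<Sum>(u, v, w)\<in>triples_le y. real (d (k - 1) u * d (l - 1) v * d (m - 1) w) *
      real (card {n. h < n \<and> real n \<le> x \<and> u dvd n + h \<and> v dvd n \<and> w dvd n - h}))"
  proof (rule sum_mono, clarify)
    fix u v w assume t: "(u, v, w) \<in> triples_le y"
    then have pos: "u > 0" "v > 0" "w > 0"
      by (auto simp: triples_le_def nats_le_def intro: Nat.gr0I)
    have "(x - real h) * sol_density h (u, v, w) - 1 \<le>
        real (card {n. h < n \<and> real n \<le> x \<and> u dvd n + h \<and> v dvd n \<and> w dvd n - h})"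
    proof (cases "g h u v w = 1")
      case True
      have "lcm u (lcm v w) > 0" using pos by (simp add: lcm_pos_nat)
      then show ?thesis
        using card_solutions_ge[OF True, of "lcm u (lcm v w)" x] h True
        by (simp add: sol_density_def dvd_lcmI1 dvd_lcmI2)
    next
      case False
      then have "g h u v w = 0" using g_cases by blast
      then show ?thesis by (simp add: sol_density_def)
    qed
    then show "real (weight k l m (u, v, w)) * ((x - real h) * sol_density h (u, v, w) - 1) \<le>
        real (d (k - 1) u * d (l - 1) v * d (m - 1) w) *
        real (card {n. h < n \<and> real n \<le> x \<and> u dvd n + h \<and> v dvd n \<and> w dvd n - h})"
      unfolding weight_def by (auto intro!: mult_left_mono)
  qed
  also have "\<dots> \<le> T k l m x h" using klm finite_triples_le by (rule T_ge_card)
  finally show ?thesis .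
qed

section \<open>Separating the smooth part\<close>

lemma coprime_prod_free_of:
  assumes "free_of B (u * v * w)" "\<And>p. p \<in> B \<Longrightarrow> prime p"
  shows "coprime (\<Prod>p\<in>B. p ^ e p) (u * v * w)"
  using assms by (intro prod_coprime_left coprime_power_left_iff[THEN iffD2])
    (auto simp: free_of_def intro!: prime_imp_coprime)

lemma squarefree_mult_imp_coprime:
  fixes a b :: nat
  assumes "squarefree (a * b)"
  shows "coprime a b"
proof (rule coprimeI)
  fix c assume "c dvd a" "c dvd b"
  then have "c ^ 2 dvd a * b" by (simp add: power2_eq_square mult_dvd_mono)
  then show "is_unit c" using assms by (rule squarefreeD[rotated])
qed

lemma g_prod_prime_powers:
  assumes "finite B" "\<And>p. p \<in> B \<Longrightarrow> prime p"
    and "\<And>p. p \<in> B \<Longrightarrow> g h (p ^ e p) (p ^ e' p) (p ^ e'' p) = 1"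
  shows "g h (\<Prod>p\<in>B. p ^ e p) (\<Prod>p\<in>B. p ^ e' p) (\<Prod>p\<in>B. p ^ e'' p) = 1"
  using assms
proof (induction B rule: finite_induct)
  case empty
  then show ?case by (simp add: g_eq_1_iff)
next
  case (insert p B)
  have "coprime (p ^ i) (\<Prod>q\<in>B. q ^ f q)" for i f
    using insert by (intro coprime_prime_power_prod) auto
  then have "coprime (p ^ e p * p ^ e' p * p ^ e'' p)
      ((\<Prod>p\<in>B. p ^ e p) * (\<Prod>p\<in>B. p ^ e' p) * (\<Prod>p\<in>B. p ^ e'' p))"
    by (simp only: coprime_mult_left_iff coprime_mult_right_iff simp_thms)
  then show ?case using g_mult insert by (simp add: insert.hyps)
qed

text \<open>The three moduli are pairwise coprime, and the congruences taken one at a time are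
  solved by \<open>- h\<close>, \<open>0\<close> and \<open>h\<close>.\<close>

lemma g_squarefree:
  assumes "squarefree (u * v * w)"
  shows "g h u v w = 1"
proof -
  have "coprime (u * v) w" using squarefree_mult_imp_coprime[of "u * v" w] assms by simp
  moreover have "coprime u v"
    using assms by (intro squarefree_mult_imp_coprime) (rule squarefree_mono[rotated], auto)
  moreover have "g h u 1 1 = 1" "g h 1 v 1 = 1" "g h 1 1 w = 1"
    by (auto simp: g_eq_1_iff intro: exI[of _ "- int h"] exI[of _ "0::int"] exI[of _ "int h"])
  ultimately show ?thesis
    using g_mult[of u 1 1 1 v 1 h] g_mult[of u v 1 1 1 w h] by simp
qed

text \<open>The summand of the local series of \<open>nabla\<close> at \<open>p\<close>, indexed by
  the triple of exponents.\<close>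

definition local_term :: "nat \<Rightarrow> nat \<Rightarrow> nat \<Rightarrow> nat \<Rightarrow> nat \<Rightarrow> nat \<times> nat \<times> nat \<Rightarrow> real" where
  "local_term h k l m p = (\<lambda>(a, b, c). real (weight k l m (p ^ a, p ^ b, p ^ c)) * sol_density h (p ^ a, p ^ b, p ^ c))"

lemma sol_density_nonneg: "sol_density h t \<ge> 0"
  by (simp add: sol_density_def g_def case_prod_unfold)

lemma local_term_nonneg: "local_term h k l m p t \<ge> 0"
  by (simp add: local_term_def sol_density_nonneg case_prod_unfold)

definition exp1 :: "(nat \<Rightarrow> nat \<times> nat \<times> nat) \<Rightarrow> nat \<Rightarrow> nat" where "exp1 \<alpha> p = fst (\<alpha> p)"
definition exp2 :: "(nat \<Rightarrow> nat \<times> nat \<times> nat) \<Rightarrow> nat \<Rightarrow> nat" where "exp2 \<alpha> p = fst (snd (\<alpha> p))"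
definition exp3 :: "(nat \<Rightarrow> nat \<times> nat \<times> nat) \<Rightarrow> nat \<Rightarrow> nat" where "exp3 \<alpha> p = snd (snd (\<alpha> p))"

definition prime_prod :: "nat set \<Rightarrow> (nat \<Rightarrow> nat) \<Rightarrow> nat" where
  "prime_prod B e = (\<Prod>p\<in>B. p ^ e p)"

lemma prime_prod_pos:
  assumes "\<And>p. p \<in> B \<Longrightarrow> prime p"
  shows "prime_prod B e > 0"
  unfolding prime_prod_def using assms by (intro prod_pos) (auto simp: prime_gt_0_nat)

text \<open>The weights factor exactly. For the densities, solvability multiplies by
  \<open>g_mult\<close>, and the lcm divides the product \<open>L\<close> of the local lcms times
  \<open>u * v * w\<close>. If some local system is unsolvable, the left side is zero.\<close>

lemma local_terms_le:
  assumes B: "finite B" "\<And>p. p \<in> B \<Longrightarrow> prime p" and free: "free_of B (u * v * w)"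
  shows "(\<Prod>p\<in>B. local_term h k l m p (\<alpha> p)) * (real (weight k l m (u, v, w)) / real (u * v * w)) \<le>
    real (weight k l m (prime_prod B (exp1 \<alpha>) * u, prime_prod B (exp2 \<alpha>) * v, prime_prod B (exp3 \<alpha>) * w)) *
    sol_density h (prime_prod B (exp1 \<alpha>) * u, prime_prod B (exp2 \<alpha>) * v, prime_prod B (exp3 \<alpha>) * w)"
proof -
  define A1 A2 A3 where "A1 = prime_prod B (exp1 \<alpha>)" "A2 = prime_prod B (exp2 \<alpha>)" "A3 = prime_prod B (exp3 \<alpha>)"
  note A = A1_A2_A3_def
  define dp where "dp p = sol_density h (p ^ exp1 \<alpha> p, p ^ exp2 \<alpha> p, p ^ exp3 \<alpha> p)" for p
  define wp where "wp p = weight k l m (p ^ exp1 \<alpha> p, p ^ exp2 \<alpha> p, p ^ exp3 \<alpha> p)" for p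
  have cop: "coprime (prime_prod B e) (u * v * w)" for e
    unfolding prime_prod_def using free B(2) by (rule coprime_prod_free_of)
  have d_A: "d j (prime_prod B e) = (\<Prod>p\<in>B. d j (p ^ e p))" for j e
    unfolding prime_prod_def using B by (rule d_prod_prime_powers)
  have weight: "weight k l m (A1 * u, A2 * v, A3 * w) = (\<Prod>p\<in>B. wp p) * weight k l m (u, v, w)"
    using cop by (simp add: A weight_def wp_def d_mult d_A prod.distrib)
  have pos: "u * v * w > 0" using free by (auto simp: free_of_def intro: Nat.gr0I)
  then have pos': "u > 0" "v > 0" "w > 0" by auto
  have Apos: "A1 > 0" "A2 > 0" "A3 > 0" unfolding A by (intro prime_prod_pos B(2); assumption)+
  have "(\<Prod>p\<in>B. dp p) / real (u * v * w) \<le> sol_density h (A1 * u, A2 * v, A3 * w)"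
  proof (cases "\<forall>p\<in>B. g h (p ^ exp1 \<alpha> p) (p ^ exp2 \<alpha> p) (p ^ exp3 \<alpha> p) = 1")
    case True
    have "g h A1 A2 A3 = 1"
      unfolding A prime_prod_def using B True by (intro g_prod_prime_powers) auto
    moreover have "coprime (A1 * A2 * A3) (u * v * w)"
      using cop by (simp add: A coprime_mult_left_iff)
    moreover have "g h u v w = 1" using free by (intro g_squarefree) (simp add: free_of_def)
    ultimately have g1: "g h (A1 * u) (A2 * v) (A3 * w) = 1" by (intro g_mult)
    define L where "L = (\<Prod>p\<in>B. lcm (p ^ exp1 \<alpha> p) (lcm (p ^ exp2 \<alpha> p) (p ^ exp3 \<alpha> p)))"
    have dL: "A1 dvd L" "A2 dvd L" "A3 dvd L"
      unfolding L_def A prime_prod_def by (auto intro!: prod_dvd_prod simp: dvd_lcmI2)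
    have "A1 * u dvd L * (u * v * w)" "A2 * v dvd L * (u * v * w)" "A3 * w dvd L * (u * v * w)"
      using dL by (auto intro!: mult_dvd_mono)
    then have "lcm (A1 * u) (lcm (A2 * v) (A3 * w)) dvd L * (u * v * w)" by (intro lcm_least)
    moreover have "L > 0"
      unfolding L_def using B(2) by (intro prod_pos) (auto simp: prime_gt_0_nat intro!: lcm_pos_nat)
    ultimately have "lcm (A1 * u) (lcm (A2 * v) (A3 * w)) \<le> L * (u * v * w)"
      using pos by (intro dvd_imp_le) auto
    then have "real (lcm (A1 * u) (lcm (A2 * v) (A3 * w))) \<le> real L * real (u * v * w)"
      by (metis of_nat_le_iff of_nat_mult)
    moreover have "lcm (A1 * u) (lcm (A2 * v) (A3 * w)) > 0"
      using pos Apos by (intro lcm_pos_nat) auto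
    ultimately have "1 / (real L * real (u * v * w)) \<le> sol_density h (A1 * u, A2 * v, A3 * w)"
      unfolding sol_density_def using g1 by (auto intro!: divide_left_mono mult_pos_pos \<open>L > 0\<close> simp: pos' simp del: of_nat_mult)
    moreover have "(\<Prod>p\<in>B. dp p) = 1 / real L"
      using True by (simp add: dp_def sol_density_def L_def prod_dividef)
    ultimately show ?thesis by simp
  next
    case False
    then obtain p where "p \<in> B" "dp p = 0"
      using g_cases unfolding dp_def sol_density_def by fastforce
    then have "(\<Prod>p\<in>B. dp p) = 0" using B(1) by (intro prod_zero) auto
    then show ?thesis by (simp add: sol_density_nonneg)
  qed
  then have "real (\<Prod>p\<in>B. wp p) * real (weight k l m (u, v, w)) * ((\<Prod>p\<in>B. dp p) / real (u * v * w)) \<le>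
      real (\<Prod>p\<in>B. wp p) * real (weight k l m (u, v, w)) * sol_density h (A1 * u, A2 * v, A3 * w)"
    by (intro mult_left_mono mult_nonneg_nonneg of_nat_0_le_iff)
  moreover have "(\<Prod>p\<in>B. local_term h k l m p (\<alpha> p)) = (\<Prod>p\<in>B. real (wp p) * dp p)"
    by (simp add: local_term_def wp_def dp_def exp1_def exp2_def exp3_def case_prod_unfold)
  ultimately show ?thesis
    unfolding A[symmetric] weight by (simp add: prod.distrib mult_ac)
qed

text \<open>The multiplicity at each \<open>p\<close> in \<open>B\<close> recovers the exponent, and
  cancelling the equal smooth parts recovers the cofactor.\<close>

lemma prime_prod_inj:
  assumes B: "finite B" "\<And>p. p \<in> B \<Longrightarrow> prime p"
    and u: "\<And>p. p \<in> B \<Longrightarrow> \<not> p dvd u" "\<And>p. p \<in> B \<Longrightarrow> \<not> p dvd u'"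
    and eq: "prime_prod B e * u = prime_prod B e' * u'"
  shows "\<And>p. p \<in> B \<Longrightarrow> e p = e' p" "u = u'"
proof -
  have mult: "multiplicity p (prime_prod B e * u) = e p" if "p \<in> B" "\<And>p. p \<in> B \<Longrightarrow> \<not> p dvd u" for p e u
  proof -
    have "u \<noteq> 0" using that(2)[OF that(1)] by (intro notI) simp
    then have "multiplicity p (prime_prod B e * u) = multiplicity p (prime_prod B e) + multiplicity p u"
      using B(2) that(1) prime_prod_pos[of B e] by (intro prime_elem_multiplicity_mult_distrib) auto
    moreover have "multiplicity p (prime_prod B e) = e p"
      unfolding prime_prod_def using multiplicity_prod_prime_powers[OF B, of p e] B(2) that(1) by simp
    ultimately show ?thesis using that by (simp add: not_dvd_imp_multiplicity_0)
  qed
  show ee: "e p = e' p" if "p \<in> B" for p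
    using mult[OF that u(1), of e] mult[OF that u(2), of e'] eq by simp
  have "prime_prod B e = prime_prod B e'" unfolding prime_prod_def by (intro prod.cong) (auto simp: ee)
  then show "u = u'" using eq prime_prod_pos[OF B(2), of B e] by simp
qed

text \<open>The exponent of \<open>p\<close> in the product of the three entries; it measures how
  much of the cutoff \<open>y\<close> the smooth part consumes.\<close>

definition exp_sum :: "nat \<times> nat \<times> nat \<Rightarrow> nat" where
  "exp_sum = (\<lambda>(a, b, c). a + b + c)"

text \<open>Grouping by the product \<open>r\<close>: the condition and the denominator depend on
  \<open>u * v * w\<close> alone, and the weights add up to
  \<open>d (k + l + m - 3) r\<close>.\<close>

lemma sum_free_eq_triples:
  assumes "k \<ge> 1" "l \<ge> 1" "m \<ge> 1"
  shows "(\<Sum>r | r \<in> nats_le y \<and> free_of B r. real (d (k + l + m - 3) r) / real r) =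
    (\<Sum>t | t \<in> triples_le y \<and> (case t of (u, v, w) \<Rightarrow> free_of B (u * v * w)).
      case t of (u, v, w) \<Rightarrow> real (weight k l m (u, v, w)) / real (u * v * w))" (is "?L = ?R")
proof -
  define K where "K = k + l + m - 3"
  have K: "k - 1 + (l - 1) + (m - 1) = K" using assms by (simp add: K_def)
  have "?R = (\<Sum>t\<in>triples_le y. if (case t of (u, v, w) \<Rightarrow> free_of B (u * v * w))
      then (case t of (u, v, w) \<Rightarrow> real (weight k l m (u, v, w)) / real (u * v * w)) else 0)"
    using finite_triples_le by (subst sum.inter_filter[symmetric]) auto
  also have "\<dots> = (\<Sum>n\<in>nats_le y. \<Sum>t\<in>triples n. if (case t of (u, v, w) \<Rightarrow> free_of B (u * v * w))
      then (case t of (u, v, w) \<Rightarrow> real (weight k l m (u, v, w)) / real (u * v * w)) else 0)"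
    by (rule sum_triples_le)
  also have "\<dots> = (\<Sum>n\<in>nats_le y. if free_of B n then real (d K n) / real n else 0)"
  proof (rule sum.cong)
    fix n assume "n \<in> nats_le y"
    then have n: "n > 0" by (simp add: nats_le_def)
    have "(\<Sum>t\<in>triples n. real (weight k l m t)) = real (d K n)"
      using sum_triples[OF n, of "k - 1" "l - 1" "m - 1"] K
      by (simp add: weight_def of_nat_sum[symmetric] del: of_nat_sum)
    then have "(if free_of B n then real (d K n) / real n else 0) =
        (\<Sum>t\<in>triples n. if free_of B n then real (weight k l m t) / real n else 0)"
      by (simp add: sum_divide_distrib[symmetric])
    also have "\<dots> = (\<Sum>t\<in>triples n. if (case t of (u, v, w) \<Rightarrow> free_of B (u * v * w))
        then (case t of (u, v, w) \<Rightarrow> real (weight k l m (u, v, w)) / real (u * v * w)) else 0)"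
      by (intro sum.cong) (auto simp: triples_def simp del: of_nat_mult)
    finally show "(\<Sum>t\<in>triples n. if (case t of (u, v, w) \<Rightarrow> free_of B (u * v * w))
        then (case t of (u, v, w) \<Rightarrow> real (weight k l m (u, v, w)) / real (u * v * w)) else 0) =
      (if free_of B n then real (d K n) / real n else 0)" ..
  qed simp
  also have "\<dots> = ?L"
    by (subst sum.inter_filter[symmetric]) (auto simp: K_def)
  finally show ?thesis ..
qed

text \<open>Multiplying a smooth triple by a cofactor triple is injective. A smooth part of total
  size \<open>s\<close> leaves room \<open>y / s\<close> for the cofactor, so the products stay in
  \<open>triples_le y\<close>, and \<open>local_terms_le\<close> compares the summands.\<close>

lemma sol_density_sum_ge:
  assumes klm: "k \<ge> 1" "l \<ge> 1" "m \<ge> 1" and B: "finite B" "\<And>p. p \<in> B \<Longrightarrow> prime p"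
  shows "(\<Sum>\<alpha>\<in>PiE B (\<lambda>_. {..N} \<times> {..N} \<times> {..N}). (\<Prod>p\<in>B. local_term h k l m p (\<alpha> p)) *
      (\<Sum>r | r \<in> nats_le (y / real (prime_prod B (exp_sum \<circ> \<alpha>))) \<and> free_of B r.
        real (d (k + l + m - 3) r) / real r)) \<le>
    (\<Sum>t\<in>triples_le y. real (weight k l m t) * sol_density h t)"
proof -
  define A where "A = PiE B (\<lambda>_. {..N} \<times> {..N} \<times> {..N})"
  define s where "s \<alpha> = prime_prod B (exp_sum \<circ> \<alpha>)" for \<alpha>
  define U where "U \<alpha> = {t. t \<in> triples_le (y / real (s \<alpha>)) \<and> (case t of (u, v, w) \<Rightarrow> free_of B (u * v * w))}" for \<alpha>
  define H where "H = (\<lambda>(u, v, w). real (weight k l m (u, v, w)) / real (u * v * w))"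
  define \<Phi> where "\<Phi> = (\<lambda>(\<alpha>, (u, v, w)). (prime_prod B (exp1 \<alpha>) * u, prime_prod B (exp2 \<alpha>) * v, prime_prod B (exp3 \<alpha>) * w))"
  define G where "G t = real (weight k l m t) * sol_density h t" for t
  have s_eq: "s \<alpha> = prime_prod B (exp1 \<alpha>) * prime_prod B (exp2 \<alpha>) * prime_prod B (exp3 \<alpha>)" for \<alpha>
    by (simp add: s_def prime_prod_def exp1_def exp2_def exp3_def exp_sum_def case_prod_unfold power_add prod.distrib)
  have s_pos: "s \<alpha> > 0" for \<alpha> unfolding s_def by (intro prime_prod_pos B(2))
  have finA: "finite A" unfolding A_def using B(1) by (intro finite_PiE) auto
  have finU: "finite (U \<alpha>)" for \<alpha>
    unfolding U_def using finite_triples_le by (rule rev_finite_subset) auto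
  have G0: "G t \<ge> 0" for t by (simp add: G_def sol_density_nonneg)
  have not_dvd: "\<not> p dvd u" "\<not> p dvd v" "\<not> p dvd w" if "p \<in> B" "(u, v, w) \<in> U \<alpha>" for p u v w \<alpha>
    using that by (auto simp: U_def free_of_def)
  have inj: "inj_on \<Phi> (SIGMA \<alpha>:A. U \<alpha>)"
  proof (rule inj_onI)
    fix z z' assume "z \<in> (SIGMA \<alpha>:A. U \<alpha>)" "z' \<in> (SIGMA \<alpha>:A. U \<alpha>)" and \<Phi>: "\<Phi> z = \<Phi> z'"
    then obtain \<alpha> u v w \<alpha>' u' v' w' where z: "z = (\<alpha>, u, v, w)" "z' = (\<alpha>', u', v', w')"
      "\<alpha> \<in> A" "\<alpha>' \<in> A" "(u, v, w) \<in> U \<alpha>" "(u', v', w') \<in> U \<alpha>'" by auto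
    note nd = not_dvd[OF _ z(5)] not_dvd[OF _ z(6)]
    have eqs: "prime_prod B (exp1 \<alpha>) * u = prime_prod B (exp1 \<alpha>') * u'"
      "prime_prod B (exp2 \<alpha>) * v = prime_prod B (exp2 \<alpha>') * v'"
      "prime_prod B (exp3 \<alpha>) * w = prime_prod B (exp3 \<alpha>') * w'"
      using \<Phi> by (auto simp: z \<Phi>_def)
    have "u = u'" "v = v'" "w = w'"
      using prime_prod_inj(2)[OF B nd(1) nd(4) eqs(1)] prime_prod_inj(2)[OF B nd(2) nd(5) eqs(2)]
        prime_prod_inj(2)[OF B nd(3) nd(6) eqs(3)] by auto
    moreover have "\<alpha> p = \<alpha>' p" if "p \<in> B" for p
      using prime_prod_inj(1)[OF B nd(1) nd(4) eqs(1) that] prime_prod_inj(1)[OF B nd(2) nd(5) eqs(2) that]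
        prime_prod_inj(1)[OF B nd(3) nd(6) eqs(3) that]
      by (simp add: exp1_def exp2_def exp3_def prod_eq_iff)
    then have "\<alpha> = \<alpha>'" using z(3,4) unfolding A_def by (blast intro: PiE_ext)
    ultimately show "z = z'" by (simp add: z)
  qed
  have im: "\<Phi> ` (SIGMA \<alpha>:A. U \<alpha>) \<subseteq> triples_le y"
  proof (rule image_subsetI)
    fix z assume "z \<in> (SIGMA \<alpha>:A. U \<alpha>)"
    then obtain \<alpha> u v w where z: "z = (\<alpha>, u, v, w)" "(u, v, w) \<in> triples_le (y / real (s \<alpha>))"
      by (auto simp: U_def)
    then have uvw: "1 \<le> u * v * w" "real (u * v * w) \<le> y / real (s \<alpha>)" by (auto simp: triples_le_def nats_le_def)
    have "real (s \<alpha> * (u * v * w)) \<le> y"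
      using uvw(2) s_pos[of \<alpha>] by (simp add: pos_le_divide_eq mult_ac)
    moreover have "1 \<le> s \<alpha> * (u * v * w)" using uvw(1) s_pos[of \<alpha>] by (simp add: Suc_le_eq)
    ultimately have "s \<alpha> * (u * v * w) \<in> nats_le y" by (simp add: nats_le_def)
    moreover have "prime_prod B (exp1 \<alpha>) * u * (prime_prod B (exp2 \<alpha>) * v) * (prime_prod B (exp3 \<alpha>) * w) = s \<alpha> * (u * v * w)"
      by (simp add: s_eq mult_ac)
    ultimately show "\<Phi> z \<in> triples_le y" by (simp only: z \<Phi>_def triples_le_def prod.case mem_Collect_eq)
  qed
  have "(\<Sum>\<alpha>\<in>A. (\<Prod>p\<in>B. local_term h k l m p (\<alpha> p)) *
      (\<Sum>r | r \<in> nats_le (y / real (s \<alpha>)) \<and> free_of B r. real (d (k + l + m - 3) r) / real r)) =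
      (\<Sum>\<alpha>\<in>A. \<Sum>t\<in>U \<alpha>. (\<Prod>p\<in>B. local_term h k l m p (\<alpha> p)) * H t)"
    using klm by (simp add: sum_free_eq_triples U_def H_def sum_distrib_left)
  also have "\<dots> = (\<Sum>(\<alpha>, t)\<in>(SIGMA \<alpha>:A. U \<alpha>). (\<Prod>p\<in>B. local_term h k l m p (\<alpha> p)) * H t)"
    using finA finU by (intro sum.Sigma) auto
  also have "\<dots> \<le> (\<Sum>z\<in>(SIGMA \<alpha>:A. U \<alpha>). G (\<Phi> z))"
  proof (rule sum_mono)
    fix z assume "z \<in> (SIGMA \<alpha>:A. U \<alpha>)"
    then obtain \<alpha> u v w where z: "z = (\<alpha>, u, v, w)" "free_of B (u * v * w)" by (auto simp: U_def)
    show "(case z of (\<alpha>, t) \<Rightarrow> (\<Prod>p\<in>B. local_term h k l m p (\<alpha> p)) * H t) \<le> G (\<Phi> z)"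
      using local_terms_le[OF B z(2), of h k l m \<alpha>] by (simp add: z(1) H_def G_def \<Phi>_def)
  qed
  also have "\<dots> = (\<Sum>t\<in>\<Phi> ` (SIGMA \<alpha>:A. U \<alpha>). G t)"
    by (subst sum.reindex[OF inj]) (simp add: comp_def)
  also have "\<dots> \<le> (\<Sum>t\<in>triples_le y. G t)"
    using im finite_triples_le G0 by (intro sum_mono2) auto
  finally show ?thesis by (simp add: A_def s_def G_def)
qed

section \<open>Summation over the smooth part\<close>

text \<open>The first moment of an additive function under a product weight. For each
  \<open>q\<close>, the sum over \<open>\<alpha>\<close> factors with \<open>c q\<close> inserted at
  \<open>q\<close>.\<close>

lemma sum_PiE_prod_additive_le:
  fixes \<phi> c :: "'a \<Rightarrow> 'b \<Rightarrow> real"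
  assumes fin: "finite B" "finite J"
    and \<phi>: "\<And>p j. \<phi> p j \<ge> 0" "\<And>p. p \<in> B \<Longrightarrow> (\<Sum>j\<in>J. \<phi> p j) \<ge> 1"
    and c: "\<And>p j. p \<in> B \<Longrightarrow> c p j \<ge> 0"
  shows "(\<Sum>\<alpha>\<in>PiE B (\<lambda>_. J). (\<Prod>p\<in>B. \<phi> p (\<alpha> p)) * (\<Sum>q\<in>B. c q (\<alpha> q))) \<le>
    (\<Prod>p\<in>B. \<Sum>j\<in>J. \<phi> p j) * (\<Sum>q\<in>B. \<Sum>j\<in>J. \<phi> q j * c q j)"
proof -
  \<comment> \<open>Puts the factor \<open>c q\<close> into coordinate \<open>q\<close> of the
    product, so that the sum over \<open>\<alpha>\<close> factors again.\<close>
  define \<psi> where "\<psi> q p j = \<phi> p j * (if p = q then c q j else 1)" for q p j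
  have "(\<Sum>\<alpha>\<in>PiE B (\<lambda>_. J). (\<Prod>p\<in>B. \<phi> p (\<alpha> p)) * (\<Sum>q\<in>B. c q (\<alpha> q))) =
      (\<Sum>\<alpha>\<in>PiE B (\<lambda>_. J). \<Sum>q\<in>B. \<Prod>p\<in>B. \<psi> q p (\<alpha> p))"
  proof (rule sum.cong)
    fix \<alpha>
    have "(\<Prod>p\<in>B. \<psi> q p (\<alpha> p)) = (\<Prod>p\<in>B. \<phi> p (\<alpha> p)) * c q (\<alpha> q)" if "q \<in> B" for q
    proof -
      have "(\<Prod>p\<in>B. if p = q then c q (\<alpha> p) else 1) = c q (\<alpha> q)"
        using fin(1) that by (simp add: prod.delta)
      then show ?thesis by (simp add: \<psi>_def prod.distrib)
    qed
    then show "(\<Prod>p\<in>B. \<phi> p (\<alpha> p)) * (\<Sum>q\<in>B. c q (\<alpha> q)) = (\<Sum>q\<in>B. \<Prod>p\<in>B. \<psi> q p (\<alpha> p))"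
      by (simp add: sum_distrib_left)
  qed simp
  also have "\<dots> = (\<Sum>q\<in>B. \<Sum>\<alpha>\<in>PiE B (\<lambda>_. J). \<Prod>p\<in>B. \<psi> q p (\<alpha> p))" by (rule sum.swap)
  also have "\<dots> = (\<Sum>q\<in>B. \<Prod>p\<in>B. \<Sum>j\<in>J. \<psi> q p j)"
    using fin by (subst prod_sum_PiE) auto
  also have "\<dots> \<le> (\<Sum>q\<in>B. (\<Prod>p\<in>B. \<Sum>j\<in>J. \<phi> p j) * (\<Sum>j\<in>J. \<phi> q j * c q j))"
  proof (rule sum_mono)
    fix q assume q: "q \<in> B"
    have S0: "(\<Sum>j\<in>J. \<phi> q j * c q j) \<ge> 0" using \<phi>(1) c[OF q] by (intro sum_nonneg) auto
    have P0: "(\<Prod>p\<in>B - {q}. \<Sum>j\<in>J. \<phi> p j) \<ge> 0" using \<phi>(1) by (intro prod_nonneg sum_nonneg) auto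
    have "(\<Prod>p\<in>B. \<Sum>j\<in>J. \<psi> q p j) = (\<Sum>j\<in>J. \<phi> q j * c q j) * (\<Prod>p\<in>B - {q}. \<Sum>j\<in>J. \<phi> p j)"
      using fin(1) q by (simp add: prod.remove[of B q] \<psi>_def)
    \<comment> \<open>The local sum at \<open>q\<close> is at least 1, so restoring it to complete
      the product only enlarges the bound.\<close>
    also have "\<dots> \<le> (\<Sum>j\<in>J. \<phi> q j * c q j) * ((\<Sum>j\<in>J. \<phi> q j) * (\<Prod>p\<in>B - {q}. \<Sum>j\<in>J. \<phi> p j))"
      using mult_right_mono[OF \<phi>(2)[OF q] P0] S0 by (intro mult_left_mono) auto
    also have "\<dots> = (\<Prod>p\<in>B. \<Sum>j\<in>J. \<phi> p j) * (\<Sum>j\<in>J. \<phi> q j * c q j)"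
      using fin(1) q by (simp add: prod.remove[of B q] mult_ac)
    finally show "(\<Prod>p\<in>B. \<Sum>j\<in>J. \<psi> q p j) \<le> (\<Prod>p\<in>B. \<Sum>j\<in>J. \<phi> p j) * (\<Sum>j\<in>J. \<phi> q j * c q j)" .
  qed
  finally show ?thesis by (simp add: sum_distrib_left)
qed

section \<open>Truncated local series and their convergence\<close>

definition cube :: "nat \<Rightarrow> (nat \<times> nat \<times> nat) set" where
  "cube N = {..N} \<times> {..N} \<times> {..N}"

lemma finite_cube [simp]: "finite (cube N)"
  by (simp add: cube_def)

text \<open>Independent of \<open>p\<close> and \<open>h\<close>, which makes the final estimate
  uniform: the factor 2 and the cube come from summing \<open>local_term_le\<close> over three
  separated exponents.\<close>

definition local_const :: "nat \<Rightarrow> nat \<Rightarrow> nat \<Rightarrow> real" where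
  "local_const k l m = 2 * power_series_bound (k + l + m) (root 3 (1 / 2)) ^ 3"

lemma root_half: "0 < root 3 (1 / 2)" "root 3 (1 / 2) < 1" "root 3 (1 / 2) ^ 3 = 1 / 2"
proof -
  show "0 < root 3 (1 / 2)" by (intro real_root_gt_zero) auto
  have "root 3 (1 / 2) < root 3 1" by (intro real_root_less_mono) auto
  then show "root 3 (1 / 2) < 1" by simp
  show "root 3 (1 / 2) ^ 3 = 1 / 2" by (intro real_root_pow_pos2) auto
qed

text \<open>For \<open>\<mu> = max a (max b c) > 0\<close> one has \<open>p ^ \<mu> \<ge> p * 2 ^ (\<mu> - 1)\<close> and \<open>a + b + c \<le> 3 * \<mu>\<close>, so
  \<open>2 powr (- (a + b + c) / 3)\<close> dominates the decay of the lcm and separates the three variables.\<close>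

lemma local_term_le:
  fixes k l m a b c :: nat
  defines "q \<equiv> root 3 (1 / 2)" and "K \<equiv> k + l + m"
  assumes p: "prime p" and klm: "k \<ge> 1" "l \<ge> 1" "m \<ge> 1"
  shows "local_term h k l m p (a, b, c) * real (a + b + c) \<le>
    2 / real p * ((real (a + 1) ^ K * q ^ a) * (real (b + 1) ^ K * q ^ b) * (real (c + 1) ^ K * q ^ c))"
proof (cases "a + b + c = 0")
  case True
  then show ?thesis by simp
next
  case False
  define \<mu> where "\<mu> = max a (max b c)"
  have \<mu>: "\<mu> \<ge> 1" "a + b + c \<le> 3 * \<mu>" using False by (auto simp: \<mu>_def)
  have p2: "real p \<ge> 2" using prime_ge_2_nat[OF p] by simp
  have q: "0 < q" "q < 1" "q ^ 3 = 1 / 2" unfolding q_def by (rule root_half)+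
  \<comment> \<open>The exponent \<open>K\<close> absorbs both the divisor function and one extra
    factor \<open>i + 1\<close>; the latter pays for
    \<open>a + b + c \<le> (a + 1) * (b + 1) * (c + 1)\<close>.\<close>
  have d: "real (d (j - 1) (p ^ i)) * real (i + 1) \<le> real (i + 1) ^ K" if "j \<ge> 1" "j \<le> K" for i j
  proof -
    have "real (d (j - 1) (p ^ i)) \<le> real (i + 1) ^ (j - 1)"
      using d_prime_power_le[OF p, of "j - 1" i] by (metis of_nat_le_iff of_nat_power)
    then have "real (d (j - 1) (p ^ i)) * real (i + 1) \<le> real (i + 1) ^ (j - 1) * real (i + 1)"
      by (intro mult_right_mono) auto
    also have "\<dots> = real (i + 1) ^ j" using that by (cases j) auto
    also have "\<dots> \<le> real (i + 1) ^ K" using that by (intro power_increasing) auto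
    finally show ?thesis .
  qed
  have sum_le: "real (a + b + c) \<le> real (a + 1) * real (b + 1) * real (c + 1)"
    by (simp add: algebra_simps)
  have "real (weight k l m (p ^ a, p ^ b, p ^ c)) * real (a + b + c) \<le>
      real (weight k l m (p ^ a, p ^ b, p ^ c)) * (real (a + 1) * real (b + 1) * real (c + 1))"
    by (intro mult_left_mono sum_le) auto
  also have "\<dots> = (real (d (k - 1) (p ^ a)) * real (a + 1)) * (real (d (l - 1) (p ^ b)) * real (b + 1)) *
      (real (d (m - 1) (p ^ c)) * real (c + 1))"
    by (simp add: weight_def)
  also have "\<dots> \<le> real (a + 1) ^ K * real (b + 1) ^ K * real (c + 1) ^ K"
    using klm by (intro mult_mono d mult_nonneg_nonneg) (auto simp: K_def)
  finally have w: "real (weight k l m (p ^ a, p ^ b, p ^ c)) * real (a + b + c) \<le>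
      real (a + 1) ^ K * real (b + 1) ^ K * real (c + 1) ^ K" .
  have "p ^ \<mu> dvd lcm (p ^ a) (lcm (p ^ b) (p ^ c))"
    by (auto simp: \<mu>_def max_def dvd_lcmI1 dvd_lcmI2)
  moreover have "lcm (p ^ a) (lcm (p ^ b) (p ^ c)) > 0"
    using p by (intro lcm_pos_nat) (auto simp: prime_gt_0_nat)
  ultimately have lcm_ge: "p ^ \<mu> \<le> lcm (p ^ a) (lcm (p ^ b) (p ^ c))" by (rule dvd_imp_le)
  have "sol_density h (p ^ a, p ^ b, p ^ c) \<le> 1 / real (p ^ \<mu>)"
    unfolding sol_density_def prod.case using g_cases[of h "p ^ a" "p ^ b" "p ^ c"] lcm_ge p2
    by (intro frac_le) (auto simp del: of_nat_power)
  also have "\<dots> \<le> 1 / (real p * 2 ^ (\<mu> - 1))"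
  proof -
    have "real p * 2 ^ (\<mu> - 1) \<le> real p * real p ^ (\<mu> - 1)"
      using p2 by (intro mult_left_mono power_mono) auto
    also have "\<dots> = real (p ^ \<mu>)" using \<mu>(1) by (cases \<mu>) auto
    finally show ?thesis using p2 by (intro divide_left_mono) auto
  qed
  also have "\<dots> = 2 / real p * (1 / 2) ^ \<mu>"
    using \<mu>(1) by (cases \<mu>) (auto simp: power_one_over)
  also have "(1 / 2 :: real) ^ \<mu> = q ^ (3 * \<mu>)" by (simp add: power_mult q(3))
  also have "2 / real p * q ^ (3 * \<mu>) \<le> 2 / real p * q ^ (a + b + c)"
    using \<mu>(2) q by (intro mult_left_mono power_decreasing) auto
  finally have dn: "sol_density h (p ^ a, p ^ b, p ^ c) \<le> 2 / real p * q ^ (a + b + c)" .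
  have "local_term h k l m p (a, b, c) * real (a + b + c) =
      (real (weight k l m (p ^ a, p ^ b, p ^ c)) * real (a + b + c)) * sol_density h (p ^ a, p ^ b, p ^ c)"
    by (simp add: local_term_def)
  also have "\<dots> \<le> (real (a + 1) ^ K * real (b + 1) ^ K * real (c + 1) ^ K) * (2 / real p * q ^ (a + b + c))"
    by (intro mult_mono w dn mult_nonneg_nonneg sol_density_nonneg) auto
  finally show ?thesis by (simp add: power_add mult_ac)
qed

text \<open>\<open>local_term_le\<close> separates the variables, so the sum factors into three
  copies of one series. The saving \<open>1 / p\<close> matters: it is what leads to sums of
  \<open>ln p / p\<close>.\<close>

lemma sum_local_term_exp_sum_le:
  assumes p: "prime p" and klm: "k \<ge> 1" "l \<ge> 1" "m \<ge> 1"
  shows "(\<Sum>t\<in>cube N. local_term h k l m p t * real (exp_sum t)) \<le> local_const k l m / real p"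
proof -
  define q where "q = root 3 (1 / 2)"
  define K where "K = k + l + m"
  define e where "e i = real (i + 1) ^ K * q ^ i" for i
  have q: "0 < q" "q < 1" unfolding q_def by (rule root_half)+
  have e0: "e i \<ge> 0" for i using q by (simp add: e_def)
  have "(\<Sum>t\<in>cube N. local_term h k l m p t * real (exp_sum t)) \<le>
      (\<Sum>(a, b, c)\<in>cube N. 2 / real p * (e a * e b * e c))"
  proof (rule sum_mono)
    fix t assume "t \<in> cube N"
    show "local_term h k l m p t * real (exp_sum t) \<le> (case t of (a, b, c) \<Rightarrow> 2 / real p * (e a * e b * e c))"
      using local_term_le[OF assms] unfolding e_def K_def q_def exp_sum_def by (cases t) (simp only: prod.case)
  qed
  also have "\<dots> = 2 / real p * (\<Sum>(a, b, c)\<in>cube N. e a * e b * e c)"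
    by (simp add: sum_distrib_left case_prod_unfold)
  also have "(\<Sum>(a, b, c)\<in>cube N. e a * e b * e c) = (\<Sum>a\<le>N. e a) * (\<Sum>b\<le>N. e b) * (\<Sum>c\<le>N. e c)"
    by (simp add: cube_def sum.cartesian_product[symmetric] sum_distrib_left[symmetric] sum_distrib_right[symmetric] mult.assoc)
  also have "2 / real p * ((\<Sum>a\<le>N. e a) * (\<Sum>b\<le>N. e b) * (\<Sum>c\<le>N. e c)) = 2 / real p * (\<Sum>a\<le>N. e a) ^ 3"
    by (simp add: power3_eq_cube)
  also have "\<dots> \<le> 2 / real p * power_series_bound K q ^ 3"
    using q e0 unfolding e_def
    by (intro mult_left_mono power_mono sum_le_power_series_bound sum_nonneg) auto
  finally show ?thesis by (simp add: local_const_def K_def q_def)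
qed

lemma local_term_0: "local_term h k l m p (0, 0, 0) = 1"
proof -
  have "d j 1 = 1" for j by (rule d_one_right)
  moreover have "g h 1 1 1 = 1" by (simp add: g_eq_1_iff)
  ultimately show ?thesis by (simp add: local_term_def weight_def sol_density_def)
qed

lemma sum_local_term_ge_1:
  shows "1 \<le> (\<Sum>t\<in>cube N. local_term h k l m p t)"
proof -
  have "(\<Sum>t\<in>{(0, 0, 0)}. local_term h k l m p t) \<le> (\<Sum>t\<in>cube N. local_term h k l m p t)"
    by (intro sum_mono2) (auto simp: cube_def local_term_nonneg)
  then show ?thesis by (simp add: local_term_0)
qed

text \<open>The cubes are cofinal among finite sets of exponents, which links unordered summation to
  limits in \<open>N\<close>.\<close>

lemma subset_cube:
  assumes "finite X"
  shows "\<exists>N. \<forall>n\<ge>N. X \<subseteq> cube n"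
proof -
  define N where "N = Max (insert 0 (exp_sum ` X))"
  have "X \<subseteq> cube n" if "n \<ge> N" for n
  proof
    fix t assume "t \<in> X"
    then have "exp_sum t \<le> N" unfolding N_def using assms by (intro Max_ge) auto
    then show "t \<in> cube n" using that by (cases t) (auto simp: exp_sum_def cube_def)
  qed
  then show ?thesis by blast
qed

text \<open>Away from the origin \<open>exp_sum\<close> is at least 1, so the bound for the weighted
  sum controls the plain one.\<close>

lemma local_term_summable:
  assumes "prime p" "k \<ge> 1" "l \<ge> 1" "m \<ge> 1"
  shows "local_term h k l m p summable_on UNIV"
proof (rule nonneg_bdd_above_summable_on)
  show "bdd_above (sum (local_term h k l m p) ` {F. F \<subseteq> UNIV \<and> finite F})"
  proof (rule bdd_aboveI2)
    fix F :: "(nat \<times> nat \<times> nat) set" assume "F \<in> {F. F \<subseteq> UNIV \<and> finite F}"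
    then obtain N where N: "F \<subseteq> cube N" using subset_cube[of F] by auto
    have "(\<Sum>t\<in>F. local_term h k l m p t) \<le> (\<Sum>t\<in>cube N. local_term h k l m p t)"
      using N by (intro sum_mono2) (auto simp: local_term_nonneg)
    also have "\<dots> = 1 + (\<Sum>t\<in>cube N - {(0, 0, 0)}. local_term h k l m p t)"
      by (subst sum.remove[of _ "(0, 0, 0)"]) (auto simp: local_term_0 cube_def)
    also have "(\<Sum>t\<in>cube N - {(0, 0, 0)}. local_term h k l m p t) \<le>
        (\<Sum>t\<in>cube N - {(0, 0, 0)}. local_term h k l m p t * real (exp_sum t))"
    proof (rule sum_mono)
      fix t assume "t \<in> cube N - {(0, 0, 0)}"
      then have "real (exp_sum t) \<ge> 1" by (cases t) (auto simp: exp_sum_def)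
      then show "local_term h k l m p t \<le> local_term h k l m p t * real (exp_sum t)"
        using mult_left_mono[of 1 "real (exp_sum t)" "local_term h k l m p t"] local_term_nonneg by simp
    qed
    also have "\<dots> \<le> (\<Sum>t\<in>cube N. local_term h k l m p t * real (exp_sum t))"
      by (intro sum_mono2) (auto simp: local_term_nonneg)
    also have "\<dots> \<le> local_const k l m / real p"
      by (rule sum_local_term_exp_sum_le[OF assms])
    finally show "(\<Sum>t\<in>F. local_term h k l m p t) \<le> 1 + local_const k l m / real p" by simp
  qed
qed (simp add: local_term_nonneg)

lemma sum_cube_tendsto:
  assumes "prime p" "k \<ge> 1" "l \<ge> 1" "m \<ge> 1"
  shows "(\<lambda>N. \<Sum>t\<in>cube N. local_term h k l m p t) \<longlonglongrightarrow> infsum (local_term h k l m p) UNIV"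
proof -
  have "(sum (local_term h k l m p) \<longlongrightarrow> infsum (local_term h k l m p) UNIV) (finite_subsets_at_top UNIV)"
    using has_sum_infsum[OF local_term_summable[OF assms]] by (simp add: has_sum_def)
  moreover have "filterlim cube (finite_subsets_at_top UNIV) sequentially"
    unfolding filterlim_finite_subsets_at_top eventually_sequentially using subset_cube by auto
  ultimately show ?thesis by (rule filterlim_compose)
qed

lemma ln_prime_prod:
  assumes "finite B" "\<And>p. p \<in> B \<Longrightarrow> prime p"
  shows "ln (real (prime_prod B e)) = (\<Sum>p\<in>B. real (e p) * ln (real p))"
proof -
  have "ln (\<Prod>p\<in>B. real p ^ e p) = (\<Sum>p\<in>B. ln (real p ^ e p))"
    using assms by (intro ln_prod) (auto simp: prime_gt_0_nat)
  also have "\<dots> = (\<Sum>p\<in>B. real (e p) * ln (real p))"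
    using assms by (intro sum.cong) (auto simp: ln_realpow prime_gt_0_nat)
  finally show ?thesis by (simp add: prime_prod_def)
qed

text \<open>Bernoulli's inequality \<open>(1 - r) ^ K \<ge> 1 - K * r\<close> applies to \<open>r = ln s / ln y \<le> 1\<close>; for
  \<open>r > 1\<close> the bound is trivial because its right-hand side is negative.\<close>

lemma sum_free_of_ge_linear:
  fixes y :: real and z s :: nat
  assumes y: "y > 1" and B: "finite B" "\<And>p. p \<in> B \<Longrightarrow> prime p"
    and z: "z \<ge> 1" "\<And>p. prime p \<Longrightarrow> p \<le> z \<Longrightarrow> p \<in> B" and K: "K \<ge> 1" and s: "s \<ge> 1"
  shows "ln y ^ K / fact K * (1 - real K * ln (real s) / ln y) \<le>
    (\<Prod>p\<in>B. (1 / (1 - 1 / real p)) ^ K) * exp (4 * power_series_bound K (1 / 2) / real z) *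
    (\<Sum>r | r \<in> nats_le (y / real s) \<and> free_of B r. real (d K r) / real r)"
proof (cases "real s \<le> y")
  case True
  define r where "r = ln (real s) / ln y"
  have ln: "ln y > 0" "ln (real s) \<ge> 0" "ln (real s) \<le> ln y" using True y s by auto
  then have r: "0 \<le> r" "r \<le> 1" by (auto simp: r_def)
  have "1 + real K * (- r) \<le> (1 + (- r)) ^ K" using r by (intro Bernoulli_inequality) auto
  then have "ln y ^ K * (1 - real K * r) \<le> ln y ^ K * (1 - r) ^ K"
    using ln by (intro mult_left_mono) auto
  also have "\<dots> = (ln y * (1 - r)) ^ K" by (simp add: power_mult_distrib)
  also have "ln y * (1 - r) = ln (y / real s)"
    using ln y s by (simp add: r_def ln_div right_diff_distrib)
  finally have "ln y ^ K * (1 - real K * r) / fact K \<le> ln (y / real s) ^ K / fact K"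
    by (rule divide_right_mono) simp
  also have "\<dots> \<le> (\<Prod>p\<in>B. (1 / (1 - 1 / real p)) ^ K) * exp (4 * power_series_bound K (1 / 2) / real z) *
    (\<Sum>r | r \<in> nats_le (y / real s) \<and> free_of B r. real (d K r) / real r)"
    using True s B z by (intro sum_free_of_ge) auto
  finally show ?thesis by (simp add: r_def)
next
  case False
  have ln: "ln y > 0" "ln y < ln (real s)" using False y by auto
  have "1 * ln (real s) \<le> real K * ln (real s)"
    using K ln by (intro mult_right_mono) auto
  then have "ln y \<le> real K * ln (real s)" using ln by linarith
  then have "1 - real K * ln (real s) / ln y \<le> 0" using ln by (simp add: field_simps)
  then have "ln y ^ K / fact K * (1 - real K * ln (real s) / ln y) \<le> 0"
    using ln by (intro mult_nonneg_nonpos) auto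
  also have "0 \<le> (\<Prod>p\<in>B. (1 / (1 - 1 / real p)) ^ K) * exp (4 * power_series_bound K (1 / 2) / real z) *
    (\<Sum>r | r \<in> nats_le (y / real s) \<and> free_of B r. real (d K r) / real r)"
    using B(2) by (intro mult_nonneg_nonneg prod_nonneg sum_nonneg) (auto simp: field_simps prime_gt_0_nat Suc_leI)
  finally show ?thesis .
qed

text \<open>A first-moment argument: the linear bound \<open>1 - K * ln s / ln y\<close> for the
  smooth part of size \<open>s\<close> is summed with weights \<open>\<Lambda>\<close>. As
  \<open>ln s\<close> is additive over \<open>B\<close>, its weighted mean is at most
  \<open>local_const\<close> times the sum of \<open>ln p / p\<close>.\<close>

lemma sol_density_sum_ge_local_sums:
  fixes y :: real and h k l m z N :: nat
  defines "M p \<equiv> \<Sum>t\<in>cube N. local_term h k l m p t"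
  defines "K \<equiv> k + l + m - 3"
  assumes klm: "k \<ge> 2" "l \<ge> 2" "m \<ge> 2"
    and y: "y > 1" and B: "finite B" "\<And>p. p \<in> B \<Longrightarrow> prime p"
    and z: "z \<ge> 1" "\<And>p. prime p \<Longrightarrow> p \<le> z \<Longrightarrow> p \<in> B"
  shows "ln y ^ K / fact K * (\<Prod>p\<in>B. (1 - 1 / real p) ^ K * M p) *
      (1 - real K * local_const k l m / ln y * (\<Sum>p\<in>B. ln (real p) / real p)) \<le>
    exp (4 * power_series_bound K (1 / 2) / real z) * (\<Sum>t\<in>triples_le y. real (weight k l m t) * sol_density h t)"
proof -
  define E where "E = exp (4 * power_series_bound K (1 / 2) / real z)"
  define Q where "Q = (\<Prod>p\<in>B. (1 / (1 - 1 / real p)) ^ K)"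
  \<comment> \<open>The reciprocal of \<open>Q\<close>; multiplying by it at the end joins the
    factors \<open>(1 - 1 / p) ^ K\<close> to the local sums.\<close>
  define R where "R = (\<Prod>p\<in>B. (1 - 1 / real p) ^ K)"
  define S where "S = (\<Sum>t\<in>triples_le y. real (weight k l m t) * sol_density h t)"
  define A where "A = PiE B (\<lambda>_. cube N)"
  define \<Lambda> where "\<Lambda> \<alpha> = (\<Prod>p\<in>B. local_term h k l m p (\<alpha> p))" for \<alpha>
  define c where "c p t = real (exp_sum t) * ln (real p)" for p t
  define F where "F \<alpha> = (\<Sum>r | r \<in> nats_le (y / real (prime_prod B (exp_sum \<circ> \<alpha>))) \<and> free_of B r. real (d K r) / real r)" for \<alpha>
  have klm1: "k \<ge> 1" "l \<ge> 1" "m \<ge> 1" and K: "K \<ge> 1" using klm by (auto simp: K_def)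
  have lny: "ln y > 0" using y by simp
  have p1: "1 - 1 / real p > 0" if "p \<in> B" for p
    using prime_gt_1_nat[OF B(2)[OF that]] by simp
  have R0: "R \<ge> 0" unfolding R_def using p1 by (intro prod_nonneg) (auto intro!: zero_le_power less_imp_le)
  have RQ: "R * Q = 1"
    unfolding R_def Q_def prod.distrib[symmetric] power_mult_distrib[symmetric]
    using p1 by (intro prod.neutral) fastforce
  have L0: "\<Lambda> \<alpha> \<ge> 0" for \<alpha> by (auto simp: \<Lambda>_def intro!: prod_nonneg local_term_nonneg)
  have M0: "M p \<ge> 0" for p unfolding M_def by (intro sum_nonneg local_term_nonneg)
  have sumL: "(\<Sum>\<alpha>\<in>A. \<Lambda> \<alpha>) = (\<Prod>p\<in>B. M p)"
    unfolding A_def \<Lambda>_def M_def using B(1) by (subst prod_sum_PiE) auto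
  have "(\<Sum>\<alpha>\<in>A. \<Lambda> \<alpha> * (\<Sum>p\<in>B. c p (\<alpha> p))) \<le> (\<Prod>p\<in>B. M p) * (\<Sum>p\<in>B. \<Sum>t\<in>cube N. local_term h k l m p t * c p t)"
    unfolding A_def \<Lambda>_def M_def
  proof (rule sum_PiE_prod_additive_le)
    show "finite B" "finite (cube N)" using B(1) by simp_all
    show "0 \<le> local_term h k l m p t" for p t by (rule local_term_nonneg)
    show "1 \<le> (\<Sum>t\<in>cube N. local_term h k l m p t)" for p by (rule sum_local_term_ge_1)
    show "0 \<le> c p t" if "p \<in> B" for p t
      using prime_gt_0_nat[OF B(2)[OF that]] by (simp add: c_def Suc_leI)
  qed
  also have "\<dots> \<le> (\<Prod>p\<in>B. M p) * (\<Sum>p\<in>B. local_const k l m * (ln (real p) / real p))"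
  proof (intro mult_left_mono sum_mono)
    fix p assume p: "p \<in> B"
    have "(\<Sum>t\<in>cube N. local_term h k l m p t * c p t) =
        (\<Sum>t\<in>cube N. local_term h k l m p t * real (exp_sum t)) * ln (real p)"
      by (simp add: c_def sum_distrib_right mult.assoc)
    also have "\<dots> \<le> local_const k l m / real p * ln (real p)"
      using sum_local_term_exp_sum_le[OF B(2)[OF p] klm1] prime_gt_0_nat[OF B(2)[OF p]]
      by (intro mult_right_mono) auto
    finally show "(\<Sum>t\<in>cube N. local_term h k l m p t * c p t) \<le> local_const k l m * (ln (real p) / real p)"
      by simp
  qed (use M0 in \<open>auto intro!: prod_nonneg\<close>)
  finally have mk: "(\<Sum>\<alpha>\<in>A. \<Lambda> \<alpha> * (\<Sum>p\<in>B. c p (\<alpha> p))) \<le>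
      (\<Prod>p\<in>B. M p) * (local_const k l m * (\<Sum>p\<in>B. ln (real p) / real p))"
    by (simp add: sum_distrib_left)
  have "ln y ^ K / fact K * ((\<Prod>p\<in>B. M p) * (1 - real K * local_const k l m / ln y * (\<Sum>p\<in>B. ln (real p) / real p))) =
      ln y ^ K / fact K * ((\<Prod>p\<in>B. M p) -
        real K / ln y * ((\<Prod>p\<in>B. M p) * (local_const k l m * (\<Sum>p\<in>B. ln (real p) / real p))))"
    by (simp add: algebra_simps)
  also have "\<dots> \<le> ln y ^ K / fact K * ((\<Sum>\<alpha>\<in>A. \<Lambda> \<alpha>) - real K / ln y * (\<Sum>\<alpha>\<in>A. \<Lambda> \<alpha> * (\<Sum>p\<in>B. c p (\<alpha> p))))"
    unfolding sumL using mk lny by (intro mult_left_mono diff_left_mono) auto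
  also have "\<dots> = (\<Sum>\<alpha>\<in>A. \<Lambda> \<alpha> * (ln y ^ K / fact K * (1 - real K * (\<Sum>p\<in>B. c p (\<alpha> p)) / ln y)))"
  proof -
    have "\<Lambda> \<alpha> * (ln y ^ K / fact K * (1 - real K * (\<Sum>p\<in>B. c p (\<alpha> p)) / ln y)) =
        ln y ^ K / fact K * (\<Lambda> \<alpha> - real K / ln y * (\<Lambda> \<alpha> * (\<Sum>p\<in>B. c p (\<alpha> p))))" for \<alpha>
      by (simp add: right_diff_distrib mult.commute mult.left_commute)
    then show ?thesis by (simp only: sum_distrib_left[symmetric] sum_subtractf)
  qed
  also have "\<dots> \<le> (\<Sum>\<alpha>\<in>A. \<Lambda> \<alpha> * (Q * E * F \<alpha>))"
  proof (intro sum_mono mult_left_mono L0)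
    fix \<alpha>
    define s where "s = prime_prod B (exp_sum \<circ> \<alpha>)"
    have s1: "s \<ge> 1" unfolding s_def using prime_prod_pos[OF B(2), of B "exp_sum \<circ> \<alpha>"] by simp
    have "ln (real s) = (\<Sum>p\<in>B. c p (\<alpha> p))"
      unfolding s_def using B by (subst ln_prime_prod) (auto simp: c_def)
    then show "ln y ^ K / fact K * (1 - real K * (\<Sum>p\<in>B. c p (\<alpha> p)) / ln y) \<le> Q * E * F \<alpha>"
      using sum_free_of_ge_linear[OF y B z K s1] by (simp add: Q_def E_def F_def s_def)
  qed
  also have "\<dots> = Q * E * (\<Sum>\<alpha>\<in>A. \<Lambda> \<alpha> * F \<alpha>)"
    by (simp add: sum_distrib_left mult_ac)
  also have "\<dots> \<le> Q * E * S"
  proof (rule mult_left_mono)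
    show "(\<Sum>\<alpha>\<in>A. \<Lambda> \<alpha> * F \<alpha>) \<le> S"
      using sol_density_sum_ge[OF klm1 B, where N = N and h = h and y = y] by (simp add: A_def \<Lambda>_def F_def S_def K_def cube_def)
    show "0 \<le> Q * E" unfolding Q_def E_def using p1 by (intro mult_nonneg_nonneg prod_nonneg) (auto simp: less_imp_le)
  qed
  finally have "R * (ln y ^ K / fact K * ((\<Prod>p\<in>B. M p) * (1 - real K * local_const k l m / ln y * (\<Sum>p\<in>B. ln (real p) / real p))))
      \<le> R * (Q * E * S)" using R0 by (rule mult_left_mono)
  also have "\<dots> = (R * Q) * E * S" by simp
  also have "\<dots> = E * S" by (simp add: RQ)
  finally show ?thesis by (simp add: R_def E_def S_def prod.distrib mult_ac)
qed

text \<open>The formula of \<open>local_factor_dvd\<close>, used at every prime of \<open>B\<close>,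
  including those where \<open>nabla\<close> has the closed form instead.\<close>

definition local_factor :: "nat \<Rightarrow> nat \<Rightarrow> nat \<Rightarrow> nat \<Rightarrow> nat \<Rightarrow> real" where
  "local_factor h k l m p = (1 - 1 / real p) ^ (k + l + m - 3) * infsum (local_term h k l m p) UNIV"

text \<open>Letting \<open>N\<close> tend to infinity completes the local series; the right side
  does not depend on \<open>N\<close>.\<close>

lemma sol_density_sum_ge_local_factors:
  fixes y :: real and h k l m z :: nat
  defines "K \<equiv> k + l + m - 3"
  assumes klm: "k \<ge> 2" "l \<ge> 2" "m \<ge> 2"
    and y: "y > 1" and B: "finite B" "\<And>p. p \<in> B \<Longrightarrow> prime p"
    and z: "z \<ge> 1" "\<And>p. prime p \<Longrightarrow> p \<le> z \<Longrightarrow> p \<in> B"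
  shows "ln y ^ K / fact K * (\<Prod>p\<in>B. local_factor h k l m p) *
      (1 - real K * local_const k l m / ln y * (\<Sum>p\<in>B. ln (real p) / real p)) \<le>
    exp (4 * power_series_bound K (1 / 2) / real z) * (\<Sum>t\<in>triples_le y. real (weight k l m t) * sol_density h t)"
proof (rule LIMSEQ_le_const2)
  have "(\<lambda>N. \<Sum>t\<in>cube N. local_term h k l m p t) \<longlonglongrightarrow> infsum (local_term h k l m p) UNIV" if "p \<in> B" for p
    using that B klm by (intro sum_cube_tendsto) auto
  then show "(\<lambda>N. ln y ^ K / fact K * (\<Prod>p\<in>B. (1 - 1 / real p) ^ K * (\<Sum>t\<in>cube N. local_term h k l m p t)) *
      (1 - real K * local_const k l m / ln y * (\<Sum>p\<in>B. ln (real p) / real p))) \<longlonglongrightarrow>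
    ln y ^ K / fact K * (\<Prod>p\<in>B. local_factor h k l m p) *
      (1 - real K * local_const k l m / ln y * (\<Sum>p\<in>B. ln (real p) / real p))"
    unfolding local_factor_def K_def[symmetric] by (intro tendsto_intros tendsto_mult tendsto_prod) auto
  show "\<exists>N0. \<forall>N\<ge>N0. ln y ^ K / fact K * (\<Prod>p\<in>B. (1 - 1 / real p) ^ K * (\<Sum>t\<in>cube N. local_term h k l m p t)) *
      (1 - real K * local_const k l m / ln y * (\<Sum>p\<in>B. ln (real p) / real p)) \<le>
    exp (4 * power_series_bound K (1 / 2) / real z) * (\<Sum>t\<in>triples_le y. real (weight k l m t) * sol_density h t)"
    unfolding K_def using sol_density_sum_ge_local_sums[OF klm y B z] by blast
qed

section \<open>The singular product\<close>

lemma local_factor_dvd_eq: "local_factor_dvd h k l m p = local_factor h k l m p"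
  unfolding local_factor_dvd_def local_factor_def local_term_def weight_def sol_density_def
  by (simp add: case_prod_unfold)

lemma local_factor_nonneg:
  assumes "prime p"
  shows "local_factor h k l m p \<ge> 0"
proof -
  have "1 - 1 / real p \<ge> 0" using prime_gt_1_nat[OF assms] by simp
  then show ?thesis
    unfolding local_factor_def by (intro mult_nonneg_nonneg zero_le_power infsum_nonneg local_term_nonneg)
qed

text \<open>On the three coordinate axes of exponents the congruences are always solvable and the
  density is \<open>1 / p ^ i\<close>. The axes sum to three Euler factors that share the origin,
  hence the \<open>- 2\<close>; all other terms are nonnegative.\<close>

lemma local_factor_not_dvd_le:
  assumes p: "prime p" and klm: "k \<ge> 1" "l \<ge> 1" "m \<ge> 1"
  shows "local_factor_not_dvd k l m p \<le> local_factor h k l m p"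
proof -
  define x where "x = 1 - 1 / real p"
  define w where "w j i = real (d (j - 1) (p ^ i)) / real p ^ i" for j i
  have x: "x > 0" using prime_gt_1_nat[OF p] by (simp add: x_def)
  have d1: "d j (Suc 0) = 1" for j
    using d_one_right by simp
  have w0: "w j 0 = 1" for j by (simp add: w_def d1)
  have g1: "g h (p ^ i) 1 1 = 1" "g h 1 (p ^ i) 1 = 1" "g h 1 1 (p ^ i) = 1" for i
    by (auto simp: g_eq_1_iff intro: exI[of _ "- int h"] exI[of _ "0::int"] exI[of _ "int h"])
  have axis: "local_term h k l m p (i, 0, 0) = w k i" "local_term h k l m p (0, i, 0) = w l i"
    "local_term h k l m p (0, 0, i) = w m i" for i
    using g1[of i] d1 by (simp_all add: local_term_def weight_def sol_density_def w_def)
  have partial: "(\<Sum>i\<le>N. w k i) + (\<Sum>i\<le>N. w l i) + (\<Sum>i\<le>N. w m i) - 2 \<le> (\<Sum>t\<in>cube N. local_term h k l m p t)" for N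
  proof -
    \<comment> \<open>\<open>X2\<close> and \<open>X3\<close> start at 1, so the origin belongs to
      \<open>X1\<close> alone.\<close>
    define X1 X2 X3 :: "(nat \<times> nat \<times> nat) set"
      where "X1 = (\<lambda>i. (i, 0, 0)) ` {..N}" "X2 = (\<lambda>i. (0, i, 0)) ` {1..N}" "X3 = (\<lambda>i. (0, 0, i)) ` {1..N}"
    note X = X1_X2_X3_def
    have split: "(\<Sum>i\<le>N. w j i) = 1 + (\<Sum>i\<in>{1..N}. w j i)" for j
      using sum.atLeast_Suc_atMost[of 0 N "w j"] by (simp add: w0 atMost_atLeast0)
    have "(\<Sum>t\<in>X1 \<union> X2 \<union> X3. local_term h k l m p t) \<le> (\<Sum>t\<in>cube N. local_term h k l m p t)"
      by (intro sum_mono2) (auto simp: X cube_def local_term_nonneg)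
    also have "(\<Sum>t\<in>X1 \<union> X2 \<union> X3. local_term h k l m p t) =
        (\<Sum>t\<in>X1. local_term h k l m p t) + (\<Sum>t\<in>X2. local_term h k l m p t) + (\<Sum>t\<in>X3. local_term h k l m p t)"
      by (subst sum.union_disjoint, (auto simp: X)[3])+ simp
    also have "(\<Sum>t\<in>X1. local_term h k l m p t) = (\<Sum>i\<le>N. w k i)"
      unfolding X by (subst sum.reindex) (auto simp: inj_on_def axis)
    also have "(\<Sum>t\<in>X2. local_term h k l m p t) = (\<Sum>i\<in>{1..N}. w l i)"
      unfolding X by (subst sum.reindex) (auto simp: inj_on_def axis)
    also have "(\<Sum>t\<in>X3. local_term h k l m p t) = (\<Sum>i\<in>{1..N}. w m i)"
      unfolding X by (subst sum.reindex) (auto simp: inj_on_def axis)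
    finally show ?thesis by (simp add: split)
  qed
  have lim: "(\<lambda>N. \<Sum>i\<le>N. w j i) \<longlonglongrightarrow> (1 / x) ^ (j - 1)" for j
    using d_prime_power_sums[OF p, of "j - 1"] unfolding sums_def_le w_def x_def .
  have le: "(1 / x) ^ (k - 1) + (1 / x) ^ (l - 1) + (1 / x) ^ (m - 1) - 2 \<le> infsum (local_term h k l m p) UNIV"
  proof (rule LIMSEQ_le)
    show "(\<lambda>N. (\<Sum>i\<le>N. w k i) + (\<Sum>i\<le>N. w l i) + (\<Sum>i\<le>N. w m i) - 2) \<longlonglongrightarrow>
        (1 / x) ^ (k - 1) + (1 / x) ^ (l - 1) + (1 / x) ^ (m - 1) - 2"
      by (intro tendsto_intros lim)
    show "(\<lambda>N. \<Sum>t\<in>cube N. local_term h k l m p t) \<longlonglongrightarrow> infsum (local_term h k l m p) UNIV"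
      using assms by (rule sum_cube_tendsto)
    show "\<exists>N0. \<forall>N\<ge>N0. (\<Sum>i\<le>N. w k i) + (\<Sum>i\<le>N. w l i) + (\<Sum>i\<le>N. w m i) - 2 \<le> (\<Sum>t\<in>cube N. local_term h k l m p t)"
      using partial by blast
  qed
  have powi: "x powi (1 - int j) = (1 / x) ^ (j - 1)" if "j \<ge> 1" for j
  proof -
    have "1 - int j = - int (j - 1)" using that by simp
    then show ?thesis by (simp only: power_int_minus power_int_of_nat) (simp add: power_one_over inverse_eq_divide)
  qed
  show ?thesis
    using mult_left_mono[OF le, of "x ^ (k + l + m - 3)"] x klm
    by (simp add: local_factor_not_dvd_def local_factor_def x_def[symmetric] powi)
qed

text \<open>Clearing denominators gives a polynomial in \<open>a\<close>, \<open>b\<close>,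
  \<open>c\<close>. Its distance from 1, expressed through \<open>\<alpha> = 1 - a\<close> and its
  analogues, has no linear terms, and each of these quantities is \<open>O(1 / p)\<close>.\<close>

lemma local_factor_not_dvd_bounds:
  assumes p: "prime p" and klm: "k \<ge> 1" "l \<ge> 1" "m \<ge> 1"
  shows "0 < local_factor_not_dvd k l m p" "local_factor_not_dvd k l m p \<le> 1"
    "1 - local_factor_not_dvd k l m p \<le> real (k * l + l * m + k * m) / real p ^ 2"
proof -
  define x where "x = 1 - 1 / real p"
  define a b c where "a = x ^ (k - 1)" "b = x ^ (l - 1)" "c = x ^ (m - 1)"
  note abc = a_b_c_def
  have x: "0 < x" "x \<le> 1" using prime_gt_1_nat[OF p] by (simp_all add: x_def)
  have pow: "0 < x ^ (j - 1)" "x ^ (j - 1) \<le> 1" "1 - x ^ (j - 1) \<le> real j / real p" for j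
  proof -
    show "0 < x ^ (j - 1)" "x ^ (j - 1) \<le> 1" using x by (auto intro: power_le_one)
    have "1 + real (j - 1) * (- (1 / real p)) \<le> (1 + (- (1 / real p))) ^ (j - 1)"
      using prime_gt_0_nat[OF p] by (intro Bernoulli_inequality) simp
    then have "1 - x ^ (j - 1) \<le> real (j - 1) / real p" by (simp add: x_def)
    also have "\<dots> \<le> real j / real p" by (intro divide_right_mono) auto
    finally show "1 - x ^ (j - 1) \<le> real j / real p" .
  qed
  have "a * b * c = x ^ (k + l + m - 3)"
    using klm by (simp add: abc power_add[symmetric]) (metis add_diff_assoc2 add_diff_assoc diff_diff_left numeral_3_eq_3 plus_1_eq_Suc)
  moreover have "x powi (1 - int j) = 1 / x ^ (j - 1)" if "j \<ge> 1" for j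
  proof -
    have "1 - int j = - int (j - 1)" using that by simp
    then show ?thesis by (simp only: power_int_minus power_int_of_nat) (simp add: inverse_eq_divide)
  qed
  ultimately have lf: "local_factor_not_dvd k l m p = a * b * c * (1 / a + 1 / b + 1 / c - 2)"
    using klm by (simp add: local_factor_not_dvd_def x_def[symmetric] abc)
  have pos: "0 < a" "0 < b" "0 < c" and le1: "a \<le> 1" "b \<le> 1" "c \<le> 1"
    unfolding abc by (rule pow)+
  have lf': "local_factor_not_dvd k l m p = b * c + a * c + a * b - 2 * a * b * c"
    using pos by (simp add: lf field_simps)
  \<comment> \<open>The factor equals the sum of these three expressions.\<close>
  have "b * c > 0" "a * c * (1 - b) \<ge> 0" "a * b * (1 - c) \<ge> 0"
    using pos le1 by simp_all
  then show "0 < local_factor_not_dvd k l m p" by (simp add: lf' algebra_simps)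
  define \<alpha> \<beta> \<gamma> where "\<alpha> = 1 - a" "\<beta> = 1 - b" "\<gamma> = 1 - c"
  note greek = \<alpha>_\<beta>_\<gamma>_def
  have gr: "0 \<le> \<alpha>" "0 \<le> \<beta>" "0 \<le> \<gamma>" "\<alpha> \<le> real k / real p" "\<beta> \<le> real l / real p" "\<gamma> \<le> real m / real p"
    using le1 pow(3) by (auto simp: greek abc)
  have one_minus: "1 - local_factor_not_dvd k l m p = \<alpha> * \<beta> + \<beta> * \<gamma> + \<alpha> * \<gamma> - 2 * (\<alpha> * \<beta> * \<gamma>)"
    by (simp add: lf' greek algebra_simps)
  \<comment> \<open>Again these three expressions add up to the quantity wanted, here the distance
    from 1.\<close>
  have "\<alpha> * \<beta> * (1 - \<gamma>) \<ge> 0" "\<beta> * \<gamma> * (1 - \<alpha>) \<ge> 0" "\<alpha> * \<gamma> \<ge> 0"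
    using gr pos by (auto simp: greek)
  then show "local_factor_not_dvd k l m p \<le> 1" using one_minus by (simp add: algebra_simps)
  have "1 - local_factor_not_dvd k l m p \<le> \<alpha> * \<beta> + \<beta> * \<gamma> + \<alpha> * \<gamma>"
    unfolding one_minus using gr by simp
  also have "\<dots> \<le> real k / real p * (real l / real p) + real l / real p * (real m / real p) + real k / real p * (real m / real p)"
    using gr by (intro add_mono mult_mono) auto
  also have "\<dots> = real (k * l + l * m + k * m) / real p ^ 2"
    by (simp add: power2_eq_square add_divide_distrib)
  finally show "1 - local_factor_not_dvd k l m p \<le> real (k * l + l * m + k * m) / real p ^ 2" .
qed

text \<open>At primes dividing \<open>2 * h\<close> the factors agree. At the other primes up to
  \<open>z\<close> they are compared by \<open>local_factor_not_dvd_le\<close>, and beyond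
  \<open>z\<close> the factors of \<open>nabla\<close> are at most 1 and are dropped.\<close>

lemma nabla_le:
  assumes klm: "k \<ge> 1" "l \<ge> 1" "m \<ge> 1" and h: "h \<ge> 1"
  shows "nabla h k l m \<le> (\<Prod>p | prime p \<and> (p \<le> z \<or> p dvd 2 * h). local_factor h k l m p)"
proof -
  define f where "f p = (if prime p \<and> \<not> p dvd 2 * h then local_factor_not_dvd k l m p else 1)" for p
  define D where "D = {p. prime p \<and> p dvd 2 * h}"
  define Z where "Z = {p. prime p \<and> \<not> p dvd 2 * h \<and> p \<le> z}"
  have finD: "finite D" unfolding D_def using h by (intro finite_subset[OF _ finite_divisors_nat[of "2 * h"]]) auto
  have finZ: "finite Z" by (simp add: Z_def)
  have f: "0 < f p" "f p \<le> 1" for p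
    using local_factor_not_dvd_bounds(1,2)[OF _ klm] by (auto simp: f_def)
  define C where "C = real (k * l + l * m + k * m)"
  \<comment> \<open>Convergence identifies \<open>prodinf f\<close> with the limit of its partial
    products.\<close>
  have "summable (\<lambda>n. norm (f n - 1))"
  proof (rule summable_comparison_test')
    show "summable (\<lambda>n. C * inverse (real n ^ 2))"
      by (intro summable_mult inverse_power_summable) simp
    fix n
    have "1 - f n \<le> C * inverse (real n ^ 2)"
      using local_factor_not_dvd_bounds(3)[OF _ klm, of n] by (auto simp: f_def C_def divide_inverse)
    then show "norm (norm (f n - 1)) \<le> C * inverse (real n ^ 2)" using f[of n] by simp
  qed
  then have "convergent_prod f"
    by (intro abs_convergent_prod_imp_convergent_prod summable_imp_abs_convergent_prod)
  then have lim: "(\<lambda>n. \<Prod>i\<le>n. f i) \<longlonglongrightarrow> prodinf f" by (rule convergent_prod_LIMSEQ)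
  have "prodinf f \<le> (\<Prod>i\<le>z. f i)"
  proof (rule LIMSEQ_le_const2[OF lim], intro exI[of _ z] allI impI)
    fix n assume "z \<le> n"
    then have "(\<Prod>i\<le>n. f i) = (\<Prod>i\<le>z. f i) * (\<Prod>i\<in>{..n} - {..z}. f i)"
      by (subst prod.subset_diff[of "{..z}"]) (auto simp: mult.commute)
    also have "\<dots> \<le> (\<Prod>i\<le>z. f i) * 1"
      using f by (intro mult_left_mono prod_le_1 prod_nonneg) (auto simp: less_imp_le)
    finally show "(\<Prod>i\<le>n. f i) \<le> (\<Prod>i\<le>z. f i)" by simp
  qed
  also have "\<dots> = (\<Prod>p\<in>Z. f p)"
    by (rule prod.mono_neutral_right) (auto simp: Z_def f_def)
  also have "\<dots> \<le> (\<Prod>p\<in>Z. local_factor h k l m p)"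
    using f local_factor_not_dvd_le[OF _ klm]
    by (intro prod_mono conjI) (auto simp: Z_def f_def less_imp_le local_factor_not_dvd_bounds(1)[OF _ klm])
  finally have "(\<Prod>p\<in>D. local_factor h k l m p) * prodinf f \<le>
      (\<Prod>p\<in>D. local_factor h k l m p) * (\<Prod>p\<in>Z. local_factor h k l m p)"
    by (rule mult_left_mono) (auto simp: D_def intro!: prod_nonneg local_factor_nonneg)
  also have "\<dots> = (\<Prod>p\<in>D \<union> Z. local_factor h k l m p)"
    using finD finZ by (subst prod.union_disjoint) (auto simp: D_def Z_def)
  also have "D \<union> Z = {p. prime p \<and> (p \<le> z \<or> p dvd 2 * h)}" by (auto simp: D_def Z_def)
  finally show ?thesis
    by (simp add: nabla_def local_factor_dvd_eq D_def f_def[abs_def])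
qed

text \<open>A prime up to \<open>z\<close> contributes at most 1. A larger prime dividing
  \<open>2 * h\<close> contributes at most \<open>ln p / z\<close>, and the product of these primes
  is at most the radical of \<open>2 * h\<close>.\<close>

lemma sum_ln_over_prime_le:
  assumes h: "h \<ge> 1" and z: "z \<ge> 1"
  shows "(\<Sum>p | prime p \<and> (p \<le> z \<or> p dvd 2 * h). ln (real p) / real p) \<le> real z + ln (real (2 * h)) / real z"
proof -
  define P1 where "P1 = {p. prime p \<and> p \<le> z}"
  define P2 where "P2 = {p. prime p \<and> \<not> p \<le> z \<and> p dvd 2 * h}"
  have fin: "finite P1" by (simp add: P1_def)
  have sub: "P2 \<subseteq> prime_factors (2 * h)"
    using h by (auto simp: P2_def in_prime_factors_iff)
  then have fin2: "finite P2" by (rule finite_subset) simp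
  have "{p. prime p \<and> (p \<le> z \<or> p dvd 2 * h)} = P1 \<union> P2" by (auto simp: P1_def P2_def)
  then have "(\<Sum>p | prime p \<and> (p \<le> z \<or> p dvd 2 * h). ln (real p) / real p) =
      (\<Sum>p\<in>P1. ln (real p) / real p) + (\<Sum>p\<in>P2. ln (real p) / real p)"
    using fin fin2 by (simp add: sum.union_disjoint[symmetric] P1_def P2_def disjoint_iff)
  also have "(\<Sum>p\<in>P1. ln (real p) / real p) \<le> (\<Sum>p\<in>P1. 1)"
  proof (rule sum_mono)
    fix p assume "p \<in> P1"
    then have "real p > 0" by (auto simp: P1_def prime_gt_0_nat)
    then show "ln (real p) / real p \<le> 1" using ln_le_minus_one[of "real p"] by (simp add: divide_le_eq)
  qed
  also have "(\<Sum>p\<in>P1. 1::real) \<le> real z"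
  proof -
    have "P1 \<subseteq> {1..z}" by (auto simp: P1_def dest: prime_ge_1_nat)
    then have "card P1 \<le> z" using card_mono[of "{1..z}" P1] by simp
    then show ?thesis by simp
  qed
  also have "(\<Sum>p\<in>P2. ln (real p) / real p) \<le> (\<Sum>p\<in>P2. ln (real p) / real z)"
    using z by (intro sum_mono divide_left_mono) (auto simp: P2_def dest: prime_ge_1_nat intro!: mult_pos_pos prime_gt_0_nat)
  also have "\<dots> = ln (real (\<Prod>p\<in>P2. p)) / real z"
  proof -
    have "ln (\<Prod>p\<in>P2. real p) = (\<Sum>p\<in>P2. ln (real p))"
      using fin2 by (intro ln_prod) (auto simp: P2_def prime_gt_0_nat)
    then show ?thesis by (simp add: sum_divide_distrib)
  qed
  also have "\<dots> \<le> ln (real (2 * h)) / real z"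
  proof (rule divide_right_mono)
    have "(\<Prod>p\<in>P2. p) \<le> (\<Prod>p\<in>prime_factors (2 * h). p)"
    proof (rule dvd_imp_le)
      show "(\<Prod>p\<in>P2. p) dvd (\<Prod>p\<in>prime_factors (2 * h). p)"
        using sub by (intro prod_dvd_prod_subset) auto
      show "0 < (\<Prod>p\<in>prime_factors (2 * h). p)"
        by (intro prod_pos) (auto simp: in_prime_factors_iff prime_gt_0_nat)
    qed
    also have "\<dots> \<le> (\<Prod>p\<in>prime_factors (2 * h). p ^ multiplicity p (2 * h))"
    proof (intro prod_mono conjI)
      fix p assume "p \<in> prime_factors (2 * h)"
      then have "multiplicity p (2 * h) \<ge> 1" "p \<ge> 1"
        by (auto simp: prime_factors_multiplicity Suc_le_eq prime_gt_0_nat)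
      then show "p \<le> p ^ multiplicity p (2 * h)" using power_increasing[of 1 "multiplicity p (2 * h)" p] by simp
    qed simp
    also have "\<dots> = 2 * h" using prime_factorization_nat[of "2 * h"] h by simp
    finally have "(\<Prod>p\<in>P2. p) \<le> 2 * h" .
    moreover have "(\<Prod>p\<in>P2. p) > 0" by (intro prod_pos) (auto simp: P2_def prime_gt_0_nat)
    ultimately show "ln (real (\<Prod>p\<in>P2. p)) \<le> ln (real (2 * h))"
      using h by (simp only: ln_le_cancel_iff of_nat_0_less_iff of_nat_le_iff)
  qed simp
  finally show ?thesis by simp
qed

section \<open>The lower bound\<close>

text \<open>A multinomial coefficient is one of several positive terms in the expansion of
  \<open>(1 + 1 + 1) ^ n\<close>. It is written as a product of two binomial coefficients, bounded
  through \<open>3 ^ n\<close> and \<open>2 ^ (b + c)\<close>.\<close>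

lemma multinomial_less:
  fixes a b c :: nat
  assumes "a \<ge> 1" "b \<ge> 1" "c \<ge> 1"
  shows "(fact (a + b + c) :: real) < 3 ^ (a + b + c) * (fact a * fact b * fact c)"
proof -
  define n where "n = a + b + c"
  \<comment> \<open>Strictness comes from here: \<open>b \<ge> 1\<close> makes \<open>0\<close> and
    \<open>b\<close> two different indices in the row.\<close>
  have "(b + c choose b) + (b + c choose 0) \<le> (\<Sum>i\<le>b + c. b + c choose i)"
    using assms sum_mono2[of "{..b + c}" "{b, 0}" "\<lambda>i. b + c choose i"] by simp
  then have b: "(b + c choose b) < 2 ^ (b + c)" by (simp add: choose_row_sum)
  have "(n choose a) * 2 ^ (n - a) \<le> (\<Sum>i\<le>n. (n choose i) * 2 ^ (n - i))"
    by (rule member_le_sum) (auto simp: n_def)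
  also have "\<dots> = 3 ^ n" using binomial_ring[of 1 "2::nat" n] by (simp add: numeral_3_eq_3)
  finally have a: "(n choose a) * 2 ^ (b + c) \<le> 3 ^ n" by (simp add: n_def)
  have "(n choose a) * (b + c choose b) < (n choose a) * 2 ^ (b + c)"
    using b by (intro mult_strict_left_mono) (auto simp: n_def)
  with a have lt: "(n choose a) * (b + c choose b) < 3 ^ n" by linarith
  have "fact a * fact (b + c) * (n choose a) = (fact n :: nat)"
    using binomial_fact_lemma[of a n] by (simp add: n_def)
  moreover have "fact b * fact c * (b + c choose b) = (fact (b + c) :: nat)"
    using binomial_fact_lemma[of b "b + c"] by simp
  ultimately have eq: "(fact n :: nat) = (n choose a) * (b + c choose b) * (fact a * fact b * fact c)"
    by (metis mult.assoc mult.commute)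
  have "(fact n :: nat) < 3 ^ n * (fact a * fact b * fact c)"
    unfolding eq using lt by (intro mult_strict_right_mono) auto
  then have "real (fact n) < real (3 ^ n * (fact a * fact b * fact c))" by (simp only: of_nat_less_iff)
  then show ?thesis by (simp add: n_def)
qed

text \<open>The hypothesis on \<open>\<rho>\<close> collects all relative losses: the shortened
  range \<open>x - h\<close>, the squarefree cofactors, the cutoff \<open>y\<close> and the first
  moment. The subtracted term is the rounding loss.\<close>

lemma T_ge_nabla_mult:
  fixes x y :: real and h k l m z :: nat
  defines "K \<equiv> k + l + m - 3"
  assumes klm: "k \<ge> 2" "l \<ge> 2" "m \<ge> 2" and h: "h \<ge> 1" "real h \<le> x" and y: "y > 1" and z: "z \<ge> 1"
    and \<rho>: "0 \<le> \<rho>" "\<rho> * x * ln x ^ K \<le> (x - real h) * exp (- (4 * power_series_bound K (1 / 2) / real z)) * ln y ^ K *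
      (1 - real K * local_const k l m / ln y * (real z + ln (real (2 * h)) / real z))" and x: "x > 1"
  shows "nabla h k l m * \<rho> * x * ln x ^ K / fact K - y * (1 + ln y) ^ K \<le> T k l m x h"
proof -
  define B where "B = {p. prime p \<and> (p \<le> z \<or> p dvd 2 * h)}"
  define P where "P = (\<Prod>p\<in>B. local_factor h k l m p)"
  define S where "S = (\<Sum>t\<in>triples_le y. real (weight k l m t) * sol_density h t)"
  define W where "W = (\<Sum>t\<in>triples_le y. real (weight k l m t))"
  define u where "u = 4 * power_series_bound K (1 / 2) / real z"
  define \<sigma> where "\<sigma> = (\<Sum>p\<in>B. ln (real p) / real p)"
  define c where "c = real K * local_const k l m / ln y"
  have klm1: "k \<ge> 1" "l \<ge> 1" "m \<ge> 1" using klm by auto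
  have "B \<subseteq> {..z} \<union> {d. d dvd 2 * h}" by (auto simp: B_def)
  then have finB: "finite B" by (rule finite_subset) (use h in simp)
  have prB: "prime p" if "p \<in> B" for p using that by (simp add: B_def)
  have lny: "ln y > 0" using y by simp
  have c0: "c \<ge> 0"
    unfolding c_def local_const_def using lny root_half power_series_bound_nonneg
    by (intro divide_nonneg_nonneg mult_nonneg_nonneg zero_le_power) auto
  have P0: "P \<ge> 0" unfolding P_def by (intro prod_nonneg local_factor_nonneg prB)
  have \<sigma>: "\<sigma> \<le> real z + ln (real (2 * h)) / real z"
    unfolding \<sigma>_def B_def by (rule sum_ln_over_prime_le[OF h(1) z])
  have "ln y ^ K / fact K * P * (1 - c * \<sigma>) \<le> exp u * S"
    unfolding K_def P_def c_def \<sigma>_def u_def S_def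
    using klm y finB prB z(1) by (rule sol_density_sum_ge_local_factors) (auto simp: B_def)
  then have "exp (- u) * (ln y ^ K / fact K * P * (1 - c * \<sigma>)) \<le> exp (- u) * (exp u * S)"
    by (intro mult_left_mono) auto
  also have "\<dots> = S" by (simp add: exp_minus)
  finally have S: "exp (- u) * (ln y ^ K / fact K * P * (1 - c * \<sigma>)) \<le> S" .
  have "nabla h k l m * (\<rho> * x * ln x ^ K) \<le> P * (\<rho> * x * ln x ^ K)"
    unfolding P_def B_def using \<rho>(1) x h klm1 by (intro mult_right_mono nabla_le) auto
  also have "\<dots> \<le> P * ((x - real h) * exp (- u) * ln y ^ K * (1 - c * (real z + ln (real (2 * h)) / real z)))"
    using \<rho>(2) P0 unfolding u_def c_def by (rule mult_left_mono)
  also have "\<dots> \<le> P * ((x - real h) * exp (- u) * ln y ^ K * (1 - c * \<sigma>))"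
    using P0 \<sigma> c0 h lny by (intro mult_left_mono diff_left_mono mult_nonneg_nonneg) auto
  finally have "nabla h k l m * (\<rho> * x * ln x ^ K) / fact K \<le>
      P * ((x - real h) * exp (- u) * ln y ^ K * (1 - c * \<sigma>)) / fact K"
    by (rule divide_right_mono) simp
  also have "\<dots> = (x - real h) * (exp (- u) * (ln y ^ K / fact K * P * (1 - c * \<sigma>)))"
    by simp
  also have "\<dots> \<le> (x - real h) * S"
    using h by (intro mult_left_mono S) auto
  also have "(x - real h) * S - W \<le> T k l m x h"
    unfolding S_def W_def using klm1 h(2) by (rule T_ge_sol_density_sum)
  then have "(x - real h) * S \<le> T k l m x h + W" by simp
  also have "W \<le> y * (1 + ln y) ^ K"
    unfolding W_def K_def using y klm1 by (intro sum_weight_triples_le) auto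
  finally show ?thesis by (simp add: mult.assoc)
qed

text \<open>The order of choices matters: \<open>z\<close> is fixed first, so large that
  \<open>exp (- C / z) * (1 - 2 * D / z)\<close> exceeds \<open>\<rho>\<close>; then
  \<open>x\<close> grows, and \<open>ln (x / ln x)\<close> is asymptotic to
  \<open>ln x\<close>.\<close>

lemma eventually_truncation_loss:
  fixes \<epsilon> \<rho> C D :: real and K :: nat
  assumes "\<epsilon> > 0" and \<rho>: "\<rho> < 1" and D: "D \<ge> 0"
  shows "\<exists>z\<ge>1. \<forall>\<^sub>F x in at_top. \<rho> \<le> (1 - x powr (- \<epsilon>)) * exp (- (C / real z)) *
    (ln (x / ln x) / ln x) ^ K * (1 - D / ln (x / ln x) * (real z + 2 * ln x / real z))"
proof -
  have "(\<lambda>z. exp (- (C / real z)) * (1 - 2 * D / real z)) \<longlonglongrightarrow> exp (- 0) * (1 - 0)"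
    by (intro tendsto_intros tendsto_divide_0[OF tendsto_const] filterlim_at_top_imp_at_infinity filterlim_real_sequentially)
  then have "eventually (\<lambda>z. \<rho> < exp (- (C / real z)) * (1 - 2 * D / real z)) sequentially"
    using \<rho> by (intro order_tendstoD(1)) auto
  moreover have "eventually (\<lambda>z::nat. z \<ge> 1) sequentially" by (rule eventually_ge_at_top)
  ultimately have "eventually (\<lambda>z. z \<ge> 1 \<and> \<rho> < exp (- (C / real z)) * (1 - 2 * D / real z)) sequentially"
    by eventually_elim simp
  then obtain z :: nat where z: "z \<ge> 1" "\<rho> < exp (- (C / real z)) * (1 - 2 * D / real z)"
    by (auto simp: eventually_sequentially)
  have l1: "((\<lambda>x::real. x powr (- \<epsilon>)) \<longlongrightarrow> 0) at_top" using \<open>\<epsilon> > 0\<close> by real_asymp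
  have l2: "((\<lambda>x::real. ln (x / ln x) / ln x) \<longlongrightarrow> 1) at_top" by real_asymp
  have l3: "((\<lambda>x::real. 1 / ln (x / ln x)) \<longlongrightarrow> 0) at_top" by real_asymp
  have l4: "((\<lambda>x::real. ln x / ln (x / ln x)) \<longlongrightarrow> 1) at_top" by real_asymp
  \<comment> \<open>The last factor is regrouped into the quotients whose limits are
    \<open>l3\<close> and \<open>l4\<close>.\<close>
  have "((\<lambda>x::real. (1 - x powr (- \<epsilon>)) * exp (- (C / real z)) * (ln (x / ln x) / ln x) ^ K *
      (1 - D * (real z * (1 / ln (x / ln x)) + 2 / real z * (ln x / ln (x / ln x))))) \<longlongrightarrow>
      (1 - 0) * exp (- (C / real z)) * 1 ^ K * (1 - D * (real z * 0 + 2 / real z * 1))) at_top"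
    by (intro tendsto_intros l1 l2 l3 l4)
  then have "\<forall>\<^sub>F x in at_top. \<rho> < (1 - x powr (- \<epsilon>)) * exp (- (C / real z)) * (ln (x / ln x) / ln x) ^ K *
      (1 - D * (real z * (1 / ln (x / ln x)) + 2 / real z * (ln x / ln (x / ln x))))"
    by (rule order_tendstoD(1)) (use z(2) in \<open>simp add: mult_ac\<close>)
  then have "\<forall>\<^sub>F x in at_top. \<rho> \<le> (1 - x powr (- \<epsilon>)) * exp (- (C / real z)) *
    (ln (x / ln x) / ln x) ^ K * (1 - D / ln (x / ln x) * (real z + 2 * ln x / real z))"
    by eventually_elim (simp add: distrib_left mult_ac)
  then show ?thesis using z(1) by blast
qed

theorem theorem1p4:
  fixes \<epsilon> :: real and k l m :: nat
  assumes "\<epsilon> > 0" and "k \<ge> 2" and "l \<ge> 2" and "m \<ge> 2"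
  shows "\<exists>C::real. \<forall>\<^sub>F x::real in at_top. \<forall>h::nat. 1 \<le> h \<and> real h \<le> x powr (1 - \<epsilon>) \<longrightarrow>
           (\<exists>E::real. \<bar>E\<bar> \<le> C * (x * ln x ^ (k + l + m - 4)) \<and>
              T k l m x h \<ge>
                nabla h k l m / 3 ^ (k + l + m - 3) *
                  (x * ln x ^ (k + l + m - 3) / (fact (k - 1) * fact (l - 1) * fact (m - 1))) + E)"
proof -
  define K where "K = k + l + m - 3"
  define F where "F = fact (k - 1) * fact (l - 1) * (fact (m - 1) :: real)"
  \<comment> \<open>The required constant divided by the available \<open>1 / fact K\<close>;
    \<open>multinomial_less\<close> makes this ratio smaller than 1.\<close>
  define \<rho> where "\<rho> = fact K / (3 ^ K * F)"
  define C where "C = 4 * power_series_bound K (1 / 2)"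
  define D where "D = real K * local_const k l m"
  have K: "K = (k - 1) + (l - 1) + (m - 1)" "k + l + m - 4 = K - 1" "K \<ge> 1"
    using assms by (auto simp: K_def)
  have F0: "F > 0" by (simp add: F_def)
  have "fact K < 3 ^ K * F"
    unfolding K(1) F_def using assms by (intro multinomial_less) auto
  then have \<rho>: "0 \<le> \<rho>" "\<rho> < 1" using F0 by (auto simp: \<rho>_def)
  have D0: "D \<ge> 0"
    unfolding D_def local_const_def using root_half power_series_bound_nonneg by simp
  obtain z where z: "z \<ge> 1" and ev: "\<forall>\<^sub>F x in at_top. \<rho> \<le> (1 - x powr (- \<epsilon>)) * exp (- (C / real z)) *
    (ln (x / ln x) / ln x) ^ K * (1 - D / ln (x / ln x) * (real z + 2 * ln x / real z))"
    using eventually_truncation_loss[OF assms(1) \<rho>(2) D0, of C K] by blast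
  have ev1: "\<forall>\<^sub>F x::real in at_top. x / ln x > 1" by real_asymp
  have ev2: "\<forall>\<^sub>F x::real in at_top. ln x \<ge> 1" by real_asymp
  have ev3: "\<forall>\<^sub>F x::real in at_top. x \<ge> 2" by (rule eventually_ge_at_top)
  show ?thesis
  \<comment> \<open>The constant comes from \<open>1 + ln y \<le> 2 * ln x\<close> in the rounding
    loss.\<close>
  proof (rule exI[of _ "2 ^ K"], use ev ev1 ev2 ev3 in eventually_elim, intro allI impI)
    fix x :: real and h :: nat
    assume main: "\<rho> \<le> (1 - x powr (- \<epsilon>)) * exp (- (C / real z)) *
        (ln (x / ln x) / ln x) ^ K * (1 - D / ln (x / ln x) * (real z + 2 * ln x / real z))"
      and y1: "x / ln x > 1" and L: "ln x \<ge> 1" and x2: "x \<ge> 2"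
      and h: "1 \<le> h \<and> real h \<le> x powr (1 - \<epsilon>)"
    \<comment> \<open>Dividing by \<open>ln x\<close> saves one logarithm in the rounding loss and
      leaves \<open>ln y\<close> asymptotic to \<open>ln x\<close>.\<close>
    define y where "y = x / ln x"
    have lny: "ln y > 0" using y1 by (simp add: y_def)
    have hx: "real h \<le> x * x powr (- \<epsilon>)"
      using h x2 by (simp add: powr_diff powr_minus_divide)
    also have "\<dots> \<le> x * 1"
      using x2 assms(1) powr_mono[of "- \<epsilon>" 0 x] by (intro mult_left_mono) auto
    finally have hx': "real h \<le> x" by simp
    \<comment> \<open>A crude bound that frees the loss from \<open>h\<close>; it is the source of
      \<open>2 * ln x\<close> in \<open>main\<close>.\<close>
    have "real (2 * h) \<le> x * x" using hx' x2 by (simp add: mult_mono)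
    then have "ln (real (2 * h)) \<le> ln (x * x)" using h x2 by (subst ln_le_cancel_iff) auto
    then have ln2h: "ln (real (2 * h)) \<le> 2 * ln x" using x2 by (simp add: ln_mult)
    define G where "G t = 1 - D / ln y * (real z + t / real z)" for t
    have "\<rho> * (x * ln x ^ K) \<le> ((1 - x powr (- \<epsilon>)) * exp (- (C / real z)) * (ln y / ln x) ^ K * G (2 * ln x)) * (x * ln x ^ K)"
      using main L x2 unfolding G_def y_def by (intro mult_right_mono) auto
    also have "\<dots> = (x - x * x powr (- \<epsilon>)) * (exp (- (C / real z)) * ln y ^ K * G (2 * ln x))"
    proof -
      have "(ln y / ln x) ^ K * ln x ^ K = ln y ^ K" using L by (simp add: power_divide)
      moreover have "((1 - w) * e * r * q) * (x * t) = (x - x * w) * (e * (r * t) * q)" for w e r q t :: real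
        by (simp add: algebra_simps)
      ultimately show ?thesis by metis
    qed
    finally have A: "\<rho> * (x * ln x ^ K) \<le> (x - x * x powr (- \<epsilon>)) * (exp (- (C / real z)) * ln y ^ K * G (2 * ln x))" .
    \<comment> \<open>The sign of \<open>G (2 * ln x)\<close> is read off from \<open>A\<close>: a
      positive left side and a nonnegative first factor force the rest to be nonnegative. This
      permits enlarging the first factor to \<open>x - h\<close>.\<close>
    have "\<rho> > 0" using F0 by (simp add: \<rho>_def)
    then have "\<rho> * (x * ln x ^ K) > 0" using x2 L by simp
    moreover have "x - x * x powr (- \<epsilon>) \<ge> 0"
      using x2 assms(1) powr_mono[of "- \<epsilon>" 0 x] by simp
    ultimately have pos: "exp (- (C / real z)) * ln y ^ K * G (2 * ln x) \<ge> 0"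
      using A by (smt (verit) mult_nonneg_nonpos)
    have "G (2 * ln x) \<le> G (ln (real (2 * h)))"
      unfolding G_def using D0 lny ln2h z by (intro diff_left_mono mult_left_mono add_left_mono divide_right_mono) auto
    then have G: "exp (- (C / real z)) * ln y ^ K * G (2 * ln x) \<le> exp (- (C / real z)) * ln y ^ K * G (ln (real (2 * h)))"
      using lny by (intro mult_left_mono) auto
    have "(x - x * x powr (- \<epsilon>)) * (exp (- (C / real z)) * ln y ^ K * G (2 * ln x)) \<le>
        (x - real h) * (exp (- (C / real z)) * ln y ^ K * G (ln (real (2 * h))))"
      using hx hx' pos G by (intro mult_mono[OF _ G]) auto
    with A have "\<rho> * (x * ln x ^ K) \<le> (x - real h) * (exp (- (C / real z)) * ln y ^ K * G (ln (real (2 * h))))"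
      by (rule order.trans)
    then have "\<rho> * x * ln x ^ K \<le> (x - real h) * exp (- (C / real z)) * ln y ^ K * G (ln (real (2 * h)))"
      by (simp only: mult.assoc)
    then have T: "nabla h k l m * \<rho> * x * ln x ^ K / fact K - y * (1 + ln y) ^ K \<le> T k l m x h"
      unfolding K_def using assms h hx' y1 z \<rho>(1) x2
      by (intro T_ge_nabla_mult[where z = z]) (auto simp: G_def y_def C_def D_def K_def)
    have "y \<le> x" using L x2 by (simp add: y_def divide_le_eq)
    then have ln_le: "ln y \<le> ln x" using y1 x2 by (simp add: y_def)
    have "y * (1 + ln y) ^ K \<le> y * (2 * ln x) ^ K"
    proof (intro mult_left_mono power_mono)
      show "1 + ln y \<le> 2 * ln x" using ln_le L by linarith
    qed (use lny y1 in \<open>auto simp: y_def\<close>)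
    also have "\<dots> = 2 ^ K * (x * ln x ^ (K - 1))"
      using L K(3) by (cases K) (auto simp: y_def power_mult_distrib)
    finally have W: "y * (1 + ln y) ^ K \<le> 2 ^ K * (x * ln x ^ (K - 1))" .
    have main_eq: "nabla h k l m * \<rho> * x * ln x ^ K / fact K = nabla h k l m / 3 ^ K * (x * ln x ^ K / F)"
      by (simp add: \<rho>_def)
    have "nabla h k l m / 3 ^ K * (x * ln x ^ K / F) + - (2 ^ K * (x * ln x ^ (K - 1))) \<le> T k l m x h"
      using T W unfolding main_eq by linarith
    moreover have "\<bar>- (2 ^ K * (x * ln x ^ (K - 1)))\<bar> \<le> 2 ^ K * (x * ln x ^ (K - 1))"
      using x2 L by simp
    ultimately show "\<exists>E. \<bar>E\<bar> \<le> 2 ^ K * (x * ln x ^ (k + l + m - 4)) \<and>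
        T k l m x h \<ge> nabla h k l m / 3 ^ (k + l + m - 3) *
          (x * ln x ^ (k + l + m - 3) / (fact (k - 1) * fact (l - 1) * fact (m - 1))) + E"
      unfolding K(2) K_def[symmetric] F_def[symmetric] by blast
  qed
qed

end
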